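(* Let $a,b,c$ be real numbers with $0<a<1$, $a\le c$ and $0<b\le\min\{1,c\}$. Then the order of convexity $\kappa$ of the shifted hypergeometric function $z\,{}_2F_1(a,b;c;z)$ satisfies $$\kappa\ \ge\ \begin{cases}\dfrac{(4-ab)c-ab(5-a-b)}{2(2c-ab)}, & \text{if } c\ge 3-a-b+ab,\\[3mm] \dfrac{2c+(a^2-5a+2)b}{2(b+c-ab)}, & \text{if } 1+a+b-ab\le c<3-a-b+ab.\end{cases}$$
   Context: $\mathbb D=\{z\in\mathbb C:|z|<1\}$. For real $a,b,c$ with $c\ne 0,-1,-2,\dots$, ${}_2F_1(a,b;c;z)=\sum_{n=0}^\infty \frac{(a)_n(b)_n}{(c)_n n!}z^n$ for $z\in\mathbb D$, where $(a)_0=1$ and $(a)_n=a(a+1)\cdots(a+n-1)$. For $f$ analytic in $\mathbb D$ with $f(0)=0$, $f'(0)=1$, the order of convexity of $f$ is $\kappa(f)=1+\inf_{z\in\mathbb D}\operatorname{Re}\frac{zf''(z)}{f'(z)}\in[-\infty,1]$; it is regarded as not defined if $f'$ has zeros in $\mathbb D$. *)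

theory Defs
  imports "HOL-Complex_Analysis.Complex_Analysis"
begin

text \<open>
  The Gauss hypergeometric function with real parameters, given by its power series. It is
  meaningful for \<open>norm z < 1\<close> and \<open>c\<close> not a non-positive integer; other values are unspecified.
\<close>
definition hyp2F1 :: "real \<Rightarrow> real \<Rightarrow> real \<Rightarrow> complex \<Rightarrow> complex" where
  "hyp2F1 a b c z =
     (\<Sum>n. of_real (pochhammer a n * pochhammer b n / (pochhammer c n * fact n)) * z ^ n)"

text \<open>
  The order of convexity is only defined for normalised analytic functions on the unit disc whose
  derivative has no zeros there. It is therefore a (functional) relation between the function
  and its order, so that \<open>has_order_of_convexity f k\<close> includes definedness. The infimum is taken
  in the extended reals: it may be \<open>-\<infinity>\<close>, and it is at most \<open>0\<close> because of the point \<open>z = 0\<close>.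
\<close>
definition has_order_of_convexity :: "(complex \<Rightarrow> complex) \<Rightarrow> ereal \<Rightarrow> bool" where
  "has_order_of_convexity f k \<longleftrightarrow>
     f holomorphic_on ball 0 1 \<and> f 0 = 0 \<and> deriv f 0 = 1 \<and>
     (\<forall>z\<in>ball 0 1. deriv f z \<noteq> 0) \<and>
     k = 1 + (INF z\<in>ball 0 1. ereal (Re (z * deriv (deriv f) z / deriv f z)))"

end

theory Submission
  imports Defs
begin

text \<open>
  Write \<open>F = F(a,b;c)\<close>, \<open>f = z F\<close> and \<open>W = z f'' / f'\<close>. The inequality comes from a Stieltjes
  representation
  \<open>W(z) = \<integral> z / (1 - t z) d\<sigma>(t)\<close> with a positive measure \<open>\<sigma>\<close> on \<open>[0,1]\<close>. Since
  \<open>Re (z / (1 - t z)) \<ge> - x / (1 + x t)\<close> whenever \<open>|z| \<le> x < 1\<close>, it gives \<open>Re W(z) \<ge> W(-x)\<close>,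
  so that only the behaviour of \<open>W\<close> at \<open>-1\<close> matters. There the hypergeometric equation expresses
  \<open>W\<close> as a Moebius function of \<open>\<omega> = z F' / F\<close>, which is monotone with a direction that depends on the
  sign of \<open>c - (3 - a - b + a b)\<close>. As \<open>F(a+1,b;c) / F\<close> is itself a Stieltjes transform
  \<open>\<integral> d\<mu>(t) / (1 - t z)\<close> with \<open>\<mu>\<close> of mass \<open>1\<close> and mean \<open>b / c\<close>, the value of \<open>\<omega>\<close> at \<open>-1\<close>
  lies between \<open>- a b / (b + c)\<close> (Jensen) and \<open>- a b / (2 c)\<close> (the chord of a convex function), and
  inserting the appropriate end point yields the two bounds.

  Measures are replaced by their moment sequences. A real power series \<open>g\<close> is called \<^emph>\<open>hausdorff\<close> when
  the two Hankel forms \<open>g\<^sub>i\<^sub>+\<^sub>j\<^sub>+\<^sub>1\<close> and \<open>g\<^sub>i\<^sub>+\<^sub>j - g\<^sub>i\<^sub>+\<^sub>j\<^sub>+\<^sub>1\<close> are positive semidefinite, that is,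
  when \<open>\<integral> t p(t)\<^sup>2\<close> and \<open>\<integral> (1 - t) p(t)\<^sup>2\<close> are nonnegative for every polynomial \<open>p\<close>. As kernels in two
  variables these forms are \<open>(g(z) - g(w)) / (z - w)\<close> and
  \<open>((z - 1) g(z) - (w - 1) g(w)) / (z - w)\<close>. Multiplying a kernel by \<open>h(z) h(w)\<close> preserves positivity,
  and for this reason the class is stable under the reciprocals that occur below: the kernel of
  \<open>- 1 / g\<close> is that of \<open>g\<close> divided by \<open>g(z) g(w)\<close>.

  Gauss's continued fraction writes \<open>F(a+1,b;c) / F(a,b;c)\<close> as an iteration of such reciprocal steps
  applied to quotients with shifted parameters (\<open>hausdorff_gauss_step\<close>, \<open>hyp_ratio_step\<close>). Each step
  gains one coefficient, so the quotient is a coefficientwise limit of hausdorff series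
  (\<open>hausdorff_hyp_ratio\<close>). With \<open>u = F / f'\<close>, \<open>\<beta> = (1 - a) (1 - b)\<close> and
  \<open>\<delta> = c - 1 - a - b + a b\<close> the differential equation becomes
  \<open>W = a b z / (1 - z) - \<delta> (1 - u) / (1 - z) + \<beta> (1 - u)\<close>. Its negative term is absorbed in one of two
  ways. For \<open>c \<le> a + b + 1\<close> one has \<open>\<delta> \<le> a b\<close>, and \<open>u / (1 - z)\<close> is hausdorff. For
  \<open>c \<ge> a + b + 1\<close> the pole at \<open>1\<close> cancels, and \<open>W = a b (y - 1) + \<beta> (1 - u)\<close> where
  \<open>y = F(a+1,b+1;c) / f'\<close> is hausdorff. Hence \<open>f'' / f'\<close> is hausdorff in both cases
  (\<open>hausdorff_log_derivative\<close>). In particular it is holomorphic in the disc, which also shows that \<open>f'\<close>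
  has no zeros there. The passage from moment sequences back to inequalities between functions is
  \<open>hausdorff_positive\<close>.
\<close>

section \<open>Positive semidefinite kernels in two formal variables\<close>

text \<open>
  A series in \<open>z\<close> with coefficients that are series in \<open>w\<close> encodes an infinite matrix, and the ring
  operations on such series encode the manipulations of kernels \<open>K(z,w)\<close>.
\<close>
definition psd :: "real fps fps \<Rightarrow> bool" where
  "psd K \<longleftrightarrow> (\<forall>N x. 0 \<le> (\<Sum>i<N. \<Sum>j<N. x i * x j * fps_nth (fps_nth K i) j))"

lemma psdD: "psd K \<Longrightarrow> 0 \<le> (\<Sum>i<N. \<Sum>j<N. x i * x j * fps_nth (fps_nth K i) j)"
  by (simp add: psd_def)

text \<open>
  The quadratic form of \<open>C K C\<^sup>T\<close> at \<open>x\<close> is that of \<open>K\<close> at \<open>C\<^sup>T x\<close>. Every stability property used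
  later is an instance, with \<open>C\<close> a triangular Toeplitz matrix, a shift or a difference.
\<close>
lemma psd_congruence:
  assumes K: "psd K"
    and L: "\<And>N. \<exists>M. \<forall>i<N. \<forall>j<N. fps_nth (fps_nth L i) j =
              (\<Sum>k<M. \<Sum>l<M. c i k * c j l * fps_nth (fps_nth K k) l)"
  shows "psd L"
  unfolding psd_def
proof (intro allI)
  fix N :: nat and x :: "nat \<Rightarrow> real"
  obtain M where M: "\<And>i j. i < N \<Longrightarrow> j < N \<Longrightarrow> fps_nth (fps_nth L i) j =
              (\<Sum>k<M. \<Sum>l<M. c i k * c j l * fps_nth (fps_nth K k) l)"
    using L[of N] by blast
  define y where "y k = (\<Sum>i<N. x i * c i k)" for k
  have "(\<Sum>i<N. \<Sum>j<N. x i * x j * fps_nth (fps_nth L i) j)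
      = (\<Sum>i<N. \<Sum>j<N. \<Sum>k<M. \<Sum>l<M. (x i * c i k) * (x j * c j l) * fps_nth (fps_nth K k) l)"
    by (intro sum.cong refl) (simp add: M sum_distrib_left mult_ac)
  also have "\<dots> = (\<Sum>i<N. \<Sum>k<M. \<Sum>j<N. \<Sum>l<M. (x i * c i k) * (x j * c j l) * fps_nth (fps_nth K k) l)"
    by (intro sum.cong refl sum.swap)
  also have "\<dots> = (\<Sum>k<M. \<Sum>i<N. \<Sum>j<N. \<Sum>l<M. (x i * c i k) * (x j * c j l) * fps_nth (fps_nth K k) l)"
    by (rule sum.swap)
  also have "\<dots> = (\<Sum>k<M. \<Sum>i<N. \<Sum>l<M. \<Sum>j<N. (x i * c i k) * (x j * c j l) * fps_nth (fps_nth K k) l)"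
    by (intro sum.cong refl sum.swap)
  also have "\<dots> = (\<Sum>k<M. \<Sum>l<M. \<Sum>i<N. \<Sum>j<N. (x i * c i k) * (x j * c j l) * fps_nth (fps_nth K k) l)"
    by (intro sum.cong refl sum.swap)
  also have "\<dots> = (\<Sum>k<M. \<Sum>l<M. y k * y l * fps_nth (fps_nth K k) l)"
    by (simp only: y_def sum_product) (simp only: sum_distrib_right)
  also have "\<dots> \<ge> 0"
    by (rule psdD[OF K])
  finally show "0 \<le> (\<Sum>i<N. \<Sum>j<N. x i * x j * fps_nth (fps_nth L i) j)" .
qed

lemma psd_add: "psd K \<Longrightarrow> psd L \<Longrightarrow> psd (K + L)"
  by (simp add: psd_def sum.distrib distrib_left add_nonneg_nonneg)

lemma psd_one: "psd 1"
proof -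
  have "(\<Sum>i<N. \<Sum>j<N. x i * x j * fps_nth (fps_nth 1 i) j) = (if N = 0 then 0 else (x 0)\<^sup>2)"
    for N :: nat and x :: "nat \<Rightarrow> real"
  proof (cases N)
    case (Suc m)
    then show ?thesis
      by (simp add: sum.lessThan_Suc_shift power2_eq_square del: sum.lessThan_Suc)
  qed simp
  then show ?thesis by (auto simp: psd_def)
qed

text \<open>The two embeddings \<open>f(z)\<close> and \<open>f(w)\<close> of a series in one variable.\<close>
definition in_z :: "real fps \<Rightarrow> real fps fps" where
  "in_z f = Abs_fps (\<lambda>i. fps_const (fps_nth f i))"

definition in_w :: "real fps \<Rightarrow> real fps fps" where
  "in_w f = fps_const f"

lemma in_z_nth [simp]: "fps_nth (in_z f) i = fps_const (fps_nth f i)"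
  by (simp add: in_z_def)

lemma fps_const_sum: "fps_const (sum f A) = (\<Sum>i\<in>A. fps_const (f i :: 'a :: comm_monoid_add))"
  by (rule fps_ext) (simp add: fps_sum_nth if_distrib cong: if_cong)

lemma in_z_hom [simp]:
  "in_z (f + g) = in_z f + in_z g" "in_z (f - g) = in_z f - in_z g"
  "in_z (- f) = - in_z f" "in_z (f * g) = in_z f * in_z g"
  "in_z 1 = 1" "in_z 0 = 0" "in_z fps_X = fps_X" "in_z (fps_const c) = in_w (fps_const c)"
proof -
  show "in_z (f * g) = in_z f * in_z g"
    by (rule fps_ext) (simp add: fps_mult_nth fps_const_sum)
  show "in_z 1 = 1"
    by (rule fps_ext) auto
  show "in_z fps_X = fps_X"
    by (rule fps_ext) auto
  show "in_z (fps_const c) = in_w (fps_const c)"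
    by (rule fps_ext) (auto simp: in_w_def)
qed (auto intro!: fps_ext)

lemma in_w_hom [simp]:
  "in_w (f + g) = in_w f + in_w g" "in_w (f - g) = in_w f - in_w g"
  "in_w (- f) = - in_w f" "in_w (f * g) = in_w f * in_w g"
  "in_w 1 = 1" "in_w 0 = 0"
  by (simp_all add: in_w_def)

lemma psd_scale_congruence:
  assumes "psd K"
  shows "psd (in_z f * in_w f * K)"
proof (rule psd_congruence[OF assms])
  fix N
  let ?c = "\<lambda>i k. if k \<le> i then fps_nth f (i - k) else 0"
  have "fps_nth (fps_nth (in_z f * in_w f * K) i) j =
      (\<Sum>k<N. \<Sum>l<N. ?c i k * ?c j l * fps_nth (fps_nth K k) l)" if "i < N" "j < N" for i j
  proof -
    have "in_z f * in_w f * K = K * in_z f * in_w f"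
      by (simp only: mult_ac)
    then have "fps_nth (fps_nth (in_z f * in_w f * K) i) j
        = fps_nth (fps_nth (K * in_z f) i * f) j"
      by (simp only: fps_mult_right_const_nth in_w_def)
    also have "\<dots> = fps_nth (\<Sum>k\<le>i. (fps_nth K k * fps_const (fps_nth f (i - k)) * f)) j"
      by (simp add: fps_mult_nth[of K] atLeast0AtMost sum_distrib_right)
    also have "\<dots> = (\<Sum>k\<le>i. \<Sum>l\<le>j. fps_nth f (i - k) * fps_nth f (j - l) * fps_nth (fps_nth K k) l)"
      by (simp add: fps_sum_nth fps_mult_nth[of _ f] atLeast0AtMost) (simp add: mult_ac)
    also have "\<dots> = (\<Sum>k\<le>i. \<Sum>l\<le>j. ?c i k * ?c j l * fps_nth (fps_nth K k) l)"
      by (intro sum.cong) auto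
    also have "\<dots> = (\<Sum>k\<le>i. \<Sum>l<N. ?c i k * ?c j l * fps_nth (fps_nth K k) l)"
      using that by (intro sum.cong refl sum.mono_neutral_left) auto
    also have "\<dots> = (\<Sum>k<N. \<Sum>l<N. ?c i k * ?c j l * fps_nth (fps_nth K k) l)"
      using that by (intro sum.mono_neutral_left) auto
    finally show ?thesis .
  qed
  then show "\<exists>M. \<forall>i<N. \<forall>j<N. fps_nth (fps_nth (in_z f * in_w f * K) i) j =
      (\<Sum>k<M. \<Sum>l<M. ?c i k * ?c j l * fps_nth (fps_nth K k) l)"
    by blast
qed

lemma psd_rank_one: "psd (in_z f * in_w f)"
  using psd_scale_congruence[OF psd_one, of f] by simp

lemma psd_scale:
  assumes "psd K" "0 \<le> c"
  shows "psd (in_w (fps_const c) * K)"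
proof -
  have "in_z (fps_const (sqrt c)) * in_w (fps_const (sqrt c)) = in_w (fps_const c)"
    using assms(2) by (simp add: in_w_def)
  then show ?thesis
    using psd_scale_congruence[OF assms(1), of "fps_const (sqrt c)"] by metis
qed

lemma psd_shift:
  assumes "psd K" and "\<And>i j. fps_nth (fps_nth L i) j = fps_nth (fps_nth K (Suc i)) (Suc j)"
  shows "psd L"
proof (rule psd_congruence[OF assms(1)])
  fix N
  show "\<exists>M. \<forall>i<N. \<forall>j<N. fps_nth (fps_nth L i) j =
    (\<Sum>k<M. \<Sum>l<M. (if k = Suc i then 1 else 0) * (if l = Suc j then 1 else 0) * fps_nth (fps_nth K k) l)"
    by (intro exI[of _ "Suc N"])
       (simp add: assms(2) if_distrib[of "\<lambda>x. x * _"] if_distrib[of "\<lambda>x. _ * x"] cong: if_cong del: sum.lessThan_Suc)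
qed

section \<open>Generating functions of Hausdorff moment sequences\<close>

definition hankel :: "real fps \<Rightarrow> real fps fps" where
  "hankel g = Abs_fps (\<lambda>i. Abs_fps (\<lambda>j. fps_nth g (i + j)))"

lemma hankel_nth [simp]: "fps_nth (fps_nth (hankel g) i) j = fps_nth g (i + j)"
  by (simp add: hankel_def)

lemma hankel_add: "hankel (f + g) = hankel f + hankel g"
  and hankel_diff: "hankel (f - g) = hankel f - hankel g"
  by (auto intro!: fps_ext)

lemma hankel_scale: "hankel (fps_const c * g) = in_w (fps_const c) * hankel g"
  by (auto intro!: fps_ext simp: in_w_def)

abbreviation Zv :: "real fps fps" where "Zv \<equiv> fps_X"
abbreviation Wv :: "real fps fps" where "Wv \<equiv> in_w fps_X"

lemma diff_mult_hankel: "(Zv - Wv) * hankel g = Zv * in_z g - Wv * in_w g"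
proof (intro fps_ext)
  fix i j
  show "fps_nth (fps_nth ((Zv - Wv) * hankel g) i) j = fps_nth (fps_nth (Zv * in_z g - Wv * in_w g) i) j"
    by (cases i; cases j) (auto simp: left_diff_distrib in_w_def)
qed

lemma Zv_neq_Wv: "Zv - Wv \<noteq> 0"
proof
  assume "Zv - Wv = 0"
  then have "fps_nth (fps_nth (Zv - Wv) 1) 0 = 0" by simp
  then show False by (simp add: in_w_def)
qed

text \<open>
  For \<open>g = \<integral> d\<mu>(t) / (1 - t z)\<close> the two forms are \<open>\<integral> t p(t)\<^sup>2 d\<mu>(t)\<close> and
  \<open>\<integral> (1 - t) p(t)\<^sup>2 d\<mu>(t)\<close>, where \<open>p\<close> has the coefficients \<open>x\<close>; they characterise measures on
  \<open>[0,1]\<close>. Multiplying the measure by \<open>t\<close> is \<open>fps_shift 1 g\<close>, and multiplying it by \<open>1 - t\<close> is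
  \<open>g - fps_shift 1 g\<close>.
\<close>
definition hausdorff :: "real fps \<Rightarrow> bool" where
  "hausdorff g \<longleftrightarrow> psd (hankel (fps_shift 1 g)) \<and> psd (hankel (g - fps_shift 1 g))"

lemma diff_mult_hankel_shift: "(Zv - Wv) * hankel (fps_shift 1 g) = in_z g - in_w g"
proof -
  have g: "g = fps_const (fps_nth g 0) + fps_X * fps_shift 1 g"
    by (rule fps_ext) (auto simp: fps_X_mult_nth)
  have "in_z g - in_w g = Zv * in_z (fps_shift 1 g) - Wv * in_w (fps_shift 1 g)"
    by (subst (1 2) g) (simp only: in_z_hom in_w_hom, simp)
  then show ?thesis by (simp add: diff_mult_hankel)
qed

lemma hausdorff_hankel: "hausdorff g \<Longrightarrow> psd (hankel g)"
  using psd_add[of "hankel (fps_shift 1 g)" "hankel (g - fps_shift 1 g)"]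
  by (simp add: hausdorff_def hankel_diff)

text \<open>Replacing \<open>p\<close> by \<open>t p\<close>, and in the next lemma by \<open>(1 - t) p\<close>, in \<open>\<integral> p\<^sup>2 d\<mu>\<close>.\<close>
lemma psd_hankel_shift2: "psd (hankel g) \<Longrightarrow> psd (hankel (fps_shift 1 (fps_shift 1 g)))"
  by (erule psd_shift) simp

lemma psd_hankel_diff2:
  assumes "psd (hankel g)"
  shows "psd (hankel (g - fps_shift 1 g - fps_shift 1 (g - fps_shift 1 g)))" (is "psd ?L")
proof (rule psd_congruence[OF assms])
  fix N :: nat
  let ?c = "\<lambda>i k :: nat. (if k = i then 1 else 0) - (if k = Suc i then 1 else 0 :: real)"
  have "fps_nth (fps_nth ?L i) j =
      (\<Sum>k<Suc N. \<Sum>l<Suc N. ?c i k * ?c j l * fps_nth (fps_nth (hankel g) k) l)"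
    if "i < N" "j < N" for i j
  proof -
    have red: "(\<Sum>k<Suc N. ?c i k * f k) = f i - f (Suc i)" if "i < N" for i and f :: "nat \<Rightarrow> real"
      using that
      by (simp add: left_diff_distrib sum_subtractf if_distrib[of "\<lambda>x. x * _"]
               cong: if_cong del: sum.lessThan_Suc)
    have "(\<Sum>k<Suc N. \<Sum>l<Suc N. ?c i k * ?c j l * fps_nth (fps_nth (hankel g) k) l)
        = (\<Sum>k<Suc N. ?c i k * (\<Sum>l<Suc N. ?c j l * fps_nth g (k + l)))"
      unfolding sum_distrib_left mult.assoc hankel_nth ..
    also have "\<dots> = fps_nth g (i + j) - fps_nth g (i + Suc j)
                    - (fps_nth g (Suc i + j) - fps_nth g (Suc i + Suc j))"
      unfolding red[OF that(2)] red[OF that(1)] ..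
    finally show ?thesis by simp
  qed
  then show "\<exists>M. \<forall>i<N. \<forall>j<N. fps_nth (fps_nth ?L i) j =
      (\<Sum>k<M. \<Sum>l<M. ?c i k * ?c j l * fps_nth (fps_nth (hankel g) k) l)"
    by blast
qed

text \<open>The weight \<open>t (1 - t)\<close> is nonnegative because it equals \<open>t (1 - t)\<^sup>2 + t\<^sup>2 (1 - t)\<close>.\<close>
lemma hausdorff_hankel_shift_diff:
  assumes "hausdorff g"
  shows "psd (hankel (fps_shift 1 (g - fps_shift 1 g)))"
proof -
  let ?S = "fps_shift 1 :: real fps \<Rightarrow> real fps"
  have "psd (hankel (?S g - ?S (?S g) - ?S (?S g - ?S (?S g))))"
    using assms by (intro psd_hankel_diff2) (simp add: hausdorff_def)
  moreover have "psd (hankel (?S (?S (g - ?S g))))"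
    using assms by (intro psd_hankel_shift2) (simp add: hausdorff_def)
  ultimately have "psd (hankel (?S g - ?S (?S g) - ?S (?S g - ?S (?S g)) + ?S (?S (g - ?S g))))"
    unfolding hankel_add by (rule psd_add)
  also have "?S g - ?S (?S g) - ?S (?S g - ?S (?S g)) + ?S (?S (g - ?S g)) = ?S (g - ?S g)"
    by (rule fps_ext) simp
  finally show ?thesis .
qed

lemma hausdorff_shift: "hausdorff g \<Longrightarrow> hausdorff (fps_shift 1 g)"
  using psd_hankel_shift2[OF hausdorff_hankel, of g] hausdorff_hankel_shift_diff[of g]
  by (simp add: hausdorff_def fps_shift_diff)

lemma hausdorff_diff_shift: "hausdorff g \<Longrightarrow> hausdorff (g - fps_shift 1 g)"
  using psd_hankel_diff2[OF hausdorff_hankel, of g] hausdorff_hankel_shift_diff[of g]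
  by (simp add: hausdorff_def)

lemma hausdorff_add: "hausdorff f \<Longrightarrow> hausdorff g \<Longrightarrow> hausdorff (f + g)"
  using psd_add[of "hankel (fps_shift 1 f)" "hankel (fps_shift 1 g)"]
    psd_add[of "hankel (f - fps_shift 1 f)" "hankel (g - fps_shift 1 g)"]
  by (simp add: hausdorff_def fps_shift_add add_diff_add flip: hankel_add)

lemma hausdorff_scale:
  assumes "hausdorff g" "0 \<le> c"
  shows "hausdorff (fps_const c * g)"
proof -
  have "fps_shift 1 (fps_const c * g) = fps_const c * fps_shift 1 g"
    by (rule fps_ext) simp
  then show ?thesis
    using assms psd_scale[of "hankel (fps_shift 1 g)" c] psd_scale[of "hankel (g - fps_shift 1 g)" c]
    by (simp add: hausdorff_def right_diff_distrib flip: hankel_scale)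
qed

lemma hausdorff_one: "hausdorff 1"
proof -
  have "hankel 0 = in_w 0 * 1" "hankel 1 = 1"
    by (auto intro!: fps_ext)
  then show ?thesis
    using psd_one psd_scale[OF psd_one, of 0] by (simp add: hausdorff_def fps_shift_one)
qed

lemma hausdorff_nth_nonneg:
  assumes "hausdorff g"
  shows "0 \<le> fps_nth g n"
  using assms
proof (induction n arbitrary: g)
  case 0
  from psdD[OF hausdorff_hankel[OF 0], of "\<lambda>_. 1" 1] show ?case by simp
next
  case (Suc n)
  from Suc.IH[OF hausdorff_shift[OF Suc.prems]] show ?case by simp
qed

lemma hausdorff_nth_le:
  assumes "hausdorff g"
  shows "fps_nth g n \<le> fps_nth g 0"
proof (induction n)
  case (Suc n)
  from hausdorff_nth_nonneg[OF hausdorff_diff_shift[OF assms], of n] Suc show ?case by simp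
qed simp

text \<open>Each quadratic form involves finitely many coefficients only.\<close>
lemma hausdorff_limit:
  assumes "\<And>n. \<exists>h. hausdorff h \<and> (\<forall>k\<le>n. fps_nth h k = fps_nth g k)"
  shows "hausdorff g"
  unfolding hausdorff_def psd_def
proof (intro conjI allI)
  fix N x
  obtain h where h: "hausdorff h" "\<And>k. k \<le> 2 * N \<Longrightarrow> fps_nth h k = fps_nth g k"
    using assms[of "2 * N"] by blast
  have "0 \<le> (\<Sum>i<N. \<Sum>j<N. x i * x j * fps_nth (fps_nth (hankel (fps_shift 1 h)) i) j)"
    using h(1) by (intro psdD) (simp add: hausdorff_def)
  also have "\<dots> = (\<Sum>i<N. \<Sum>j<N. x i * x j * fps_nth (fps_nth (hankel (fps_shift 1 g)) i) j)"
    by (intro sum.cong refl) (simp add: h(2))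
  finally show "0 \<le> \<dots>" .
  have "0 \<le> (\<Sum>i<N. \<Sum>j<N. x i * x j * fps_nth (fps_nth (hankel (h - fps_shift 1 h)) i) j)"
    using h(1) by (intro psdD) (simp add: hausdorff_def)
  also have "\<dots> = (\<Sum>i<N. \<Sum>j<N. x i * x j * fps_nth (fps_nth (hankel (g - fps_shift 1 g)) i) j)"
    by (intro sum.cong refl) (simp add: h(2))
  finally show "0 \<le> \<dots>" .
qed

section \<open>Duality, reciprocals and the step of Gauss's continued fraction\<close>

definition geom :: "real fps" where "geom = Abs_fps (\<lambda>_. 1)"

lemma geom_mult: "(1 - fps_X) * geom = 1"
proof (rule fps_ext)
  fix n show "fps_nth ((1 - fps_X) * geom) n = fps_nth 1 n"
    by (cases n) (auto simp: left_diff_distrib geom_def)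
qed

lemma hausdorff_geom: "hausdorff geom"
proof -
  have "fps_shift 1 geom = geom" "hankel geom = in_z geom * in_w geom" "hankel 0 = in_w (fps_const 0) * 1"
    by (auto intro!: fps_ext simp: geom_def in_w_def)
  then show ?thesis
    using psd_rank_one[of geom] psd_scale[OF psd_one, of 0] by (simp add: hausdorff_def)
qed

text \<open>
  Identities between kernels are proved by multiplying with \<open>z - w\<close>, which is not a zero divisor and
  turns every Hankel kernel into a difference of functions of a single variable.
\<close>
lemma hankel_shift_eqI:
  assumes "(Zv - Wv) * K = in_z g - in_w g"
  shows "hankel (fps_shift 1 g) = K"
  using assms diff_mult_hankel_shift[of g] Zv_neq_Wv by (metis mult_left_cancel)

lemma diff_mult_hankel_diff:
  "(Zv - Wv) * hankel (g - fps_shift 1 g) = (Zv - 1) * in_z g - (Wv - 1) * in_w g"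
  using diff_mult_hankel[of g] diff_mult_hankel_shift[of g]
  unfolding hankel_diff by algebra

lemma hankel_diff_eqI:
  assumes "(Zv - Wv) * K = (Zv - 1) * in_z g - (Wv - 1) * in_w g"
  shows "hankel (g - fps_shift 1 g) = K"
  using assms diff_mult_hankel_diff[of g] Zv_neq_Wv by (metis mult_left_cancel)

lemma in_mult_eq:
  assumes "f * g = h"
  shows "in_z f * in_z g = in_z h" "in_w f * in_w g = in_w h"
  using assms by (auto simp flip: in_z_hom in_w_hom)

text \<open>
  For \<open>v = 1 / ((1 - z) r)\<close> the functions \<open>- 1 / v = (z - 1) r\<close> and \<open>(z - 1) v = - 1 / r\<close> show that the
  two kernels of \<open>v\<close> are the two kernels of \<open>r\<close>, exchanged and divided by \<open>(1 - z) r(z) (1 - w) r(w)\<close>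
  or \<open>r(z) r(w)\<close>.
\<close>
lemma hausdorff_dual:
  assumes r: "hausdorff r" and u: "r * u = 1"
  shows "hausdorff (u * geom)"
proof -
  define v where "v = u * geom"
  have rv: "(1 - fps_X) * (r * v) = 1"
  proof -
    have "(1 - fps_X) * (r * v) = (r * u) * ((1 - fps_X) * geom)"
      by (simp add: v_def mult_ac)
    then show ?thesis by (simp add: u geom_mult)
  qed
  have uv: "(1 - fps_X) * v = u"
    unfolding v_def using geom_mult by algebra
  let ?z = "Zv" and ?w = "Wv"
  have z1: "(1 - ?z) * (in_z r * in_z v) = 1" using in_mult_eq(1)[OF rv] by simp
  have w1: "(1 - ?w) * (in_w r * in_w v) = 1"
    using in_mult_eq(2)[OF rv] by simp
  have z2: "(1 - ?z) * in_z v = in_z u" using in_mult_eq(1)[OF uv] by simp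
  have w2: "(1 - ?w) * in_w v = in_w u" using in_mult_eq(2)[OF uv] by simp
  have z3: "in_z r * in_z u = 1" using in_mult_eq(1)[OF u] by simp
  have w3: "in_w r * in_w u = 1" using in_mult_eq(2)[OF u] by simp
  have "hankel (fps_shift 1 v) = in_z v * in_w v * hankel (r - fps_shift 1 r)"
  proof (rule hankel_shift_eqI)
    have "(?z - ?w) * (in_z v * in_w v * hankel (r - fps_shift 1 r))
        = in_z v * in_w v * ((?z - ?w) * hankel (r - fps_shift 1 r))"
      by (simp only: mult_ac)
    also have "\<dots> = in_z v * in_w v * ((?z - 1) * in_z r - (?w - 1) * in_w r)"
      by (simp only: diff_mult_hankel_diff)
    also have "\<dots> = in_z v - in_w v"
      using z1 w1 by algebra
    finally show "(?z - ?w) * (in_z v * in_w v * hankel (r - fps_shift 1 r)) = in_z v - in_w v" .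
  qed
  moreover have "psd (hankel (r - fps_shift 1 r))" "psd (hankel (fps_shift 1 r))"
    using r by (auto simp: hausdorff_def)
  moreover have "hankel (v - fps_shift 1 v) = in_z u * in_w u * hankel (fps_shift 1 r)"
  proof (rule hankel_diff_eqI)
    have "(?z - ?w) * (in_z u * in_w u * hankel (fps_shift 1 r))
        = in_z u * in_w u * ((?z - ?w) * hankel (fps_shift 1 r))"
      by (simp only: mult_ac)
    also have "\<dots> = in_z u * in_w u * (in_z r - in_w r)"
      by (simp only: diff_mult_hankel_shift)
    also have "\<dots> = in_w u - in_z u"
      using z3 w3 by algebra
    also have "\<dots> = (?z - 1) * in_z v - (?w - 1) * in_w v"
      unfolding z2[symmetric] w2[symmetric] by (simp add: algebra_simps)
    finally show "(?z - ?w) * (in_z u * in_w u * hankel (fps_shift 1 r)) = (?z - 1) * in_z v - (?w - 1) * in_w v" .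
  qed
  ultimately show ?thesis
    unfolding hausdorff_def v_def[symmetric] by (simp add: psd_scale_congruence)
qed

text \<open>
  With \<open>1 / r = u = 1 - z s\<close>, the Hankel kernel of \<open>r\<close> times \<open>u(z) u(w)\<close> is \<open>1 + z w D\<close>, where \<open>D\<close> is the
  first kernel of \<open>s\<close>. Deleting the first row and column therefore leaves \<open>D\<close>. The second kernel of
  \<open>s\<close> is a rank one kernel plus the kernel of weight \<open>t (1 - t)\<close> of \<open>r\<close> times \<open>u(z) u(w)\<close>.
\<close>
lemma hausdorff_inverse_shift:
  assumes r: "hausdorff r" "fps_nth r 0 = 1" and u: "r * u = 1"
  shows "hausdorff (- fps_shift 1 u)"
proof -
  define s where "s = - fps_shift 1 u"
  define r1 where "r1 = fps_shift 1 r"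
  let ?z = "Zv" and ?w = "Wv"
  have u0: "fps_nth u 0 = 1"
    using arg_cong[OF u, of "\<lambda>f. fps_nth f 0"] r(2) by simp
  have us: "u + fps_X * s = 1"
    by (rule fps_ext) (auto simp: s_def u0)
  have rr1: "1 + fps_X * r1 = r"
    by (rule fps_ext) (auto simp: r1_def r(2))
  have "fps_X * s = fps_X * (u * r1)"
    using us rr1 u by algebra
  then have s_eq: "u * r1 = s" by simp
  have z1: "in_z r * in_z u = 1" using in_mult_eq(1)[OF u] by simp
  have w1: "in_w r * in_w u = 1" using in_mult_eq(2)[OF u] by simp
  have z2: "in_z u + ?z * in_z s = 1"
    using arg_cong[OF us, of in_z] by simp
  have w2: "in_w u + ?w * in_w s = 1"
    using arg_cong[OF us, of in_w] by simp
  have z3: "in_z r = 1 + ?z * in_z r1"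
    using arg_cong[OF rr1, of in_z] by simp
  have w3: "in_w r = 1 + ?w * in_w r1"
    using arg_cong[OF rr1, of in_w] by simp
  have z4: "in_z s = in_z u * in_z r1" using in_mult_eq(1)[OF s_eq] by simp
  have w4: "in_w s = in_w u * in_w r1" using in_mult_eq(2)[OF s_eq] by simp
  have eq1: "in_z u * in_w u * hankel r = 1 + ?z * (?w * hankel (fps_shift 1 s))"
  proof -
    have "(?z - ?w) * (in_z u * in_w u * hankel r) = in_z u * in_w u * ((?z - ?w) * hankel r)"
      by (simp only: mult_ac)
    also have "\<dots> = in_z u * in_w u * (?z * in_z r - ?w * in_w r)"
      by (simp only: diff_mult_hankel)
    also have "\<dots> = (?z - ?w) + ?z * ?w * (in_z s - in_w s)"
      using z1 w1 z2 w2 by algebra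
    also have "\<dots> = (?z - ?w) + ?z * ?w * ((?z - ?w) * hankel (fps_shift 1 s))"
      by (simp only: diff_mult_hankel_shift)
    also have "\<dots> = (?z - ?w) * (1 + ?z * (?w * hankel (fps_shift 1 s)))"
      by algebra
    finally show ?thesis
      using Zv_neq_Wv by (metis mult_left_cancel)
  qed
  \<comment> \<open>The constant \<open>1\<close> in \<open>eq1\<close> only affects the entry \<open>(0,0)\<close>, which the shift removes.\<close>
  have "psd (hankel (fps_shift 1 s))"
  proof (rule psd_shift)
    show "psd (in_z u * in_w u * hankel r)"
      by (intro psd_scale_congruence hausdorff_hankel r)
    show "fps_nth (fps_nth (hankel (fps_shift 1 s)) i) j =
        fps_nth (fps_nth (in_z u * in_w u * hankel r) (Suc i)) (Suc j)" for i j
      unfolding eq1 by (simp add: in_w_def)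
  qed
  moreover have "hankel (s - fps_shift 1 s) =
      in_z s * in_w s + in_z u * in_w u * hankel (fps_shift 1 (r - fps_shift 1 r))"
  proof (rule hankel_diff_eqI)
    have "(?z - ?w) * (in_z s * in_w s + in_z u * in_w u * hankel (fps_shift 1 (r - fps_shift 1 r)))
        = (?z - ?w) * (in_z s * in_w s)
          + in_z u * in_w u * ((?z - ?w) * hankel (fps_shift 1 (r - fps_shift 1 r)))"
      by algebra
    also have "\<dots> = (?z - ?w) * (in_z s * in_w s)
          + in_z u * in_w u * (in_z r - in_z r1 - (in_w r - in_w r1))"
      by (simp only: diff_mult_hankel_shift in_z_hom in_w_hom r1_def)
    also have "\<dots> = (?z - 1) * in_z s - (?w - 1) * in_w s"
      using z1 w1 z3 w3 z4 w4 by algebra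
    finally show "(?z - ?w) * (in_z s * in_w s + in_z u * in_w u * hankel (fps_shift 1 (r - fps_shift 1 r)))
        = (?z - 1) * in_z s - (?w - 1) * in_w s" .
  qed
  ultimately show ?thesis
    unfolding hausdorff_def s_def[symmetric]
    using r(1) by (simp add: psd_add psd_rank_one psd_scale_congruence hausdorff_hankel_shift_diff
        del: One_nat_def)
qed

text \<open>
  One level of a continued fraction with parameter \<open>g \<in> [0,1]\<close> (a g-fraction in Wall's sense). Both
  kernels of \<open>p\<close> are \<open>f(z) f(w)\<close>, with \<open>f = p / r\<close>, times a sum of visibly nonnegative kernels
  built from \<open>q\<close>. The normalisation of \<open>q\<close> enters through the constant term \<open>1\<close> of the second one.
\<close>
lemma hausdorff_gauss_step:
  assumes q: "hausdorff q" "fps_nth q 0 = 1" and g: "0 \<le> g" "g \<le> 1"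
    and r: "r = fps_const (1 - g) + fps_const g * q" and ir: "r * ir = 1"
    and p: "p * (1 - fps_X * (fps_const g * (q * ir))) = 1"
  shows "hausdorff p"
proof -
  let ?z = "Zv" and ?w = "Wv" and ?G = "in_w (fps_const g)" and ?q1 = "fps_shift 1 q"
  have c: "fps_const (1 - g) = 1 - fps_const g" by (simp add: fps_eq_iff)
  have z1: "in_z r = 1 - ?G + ?G * in_z q" and w1: "in_w r = 1 - ?G + ?G * in_w q"
    by (simp_all add: r c)
  have z2: "in_z r * in_z ir = 1" using in_mult_eq(1)[OF ir] by simp
  have w2: "in_w r * in_w ir = 1" using in_mult_eq(2)[OF ir] by simp
  have z3: "in_z p * (1 - ?z * (?G * (in_z q * in_z ir))) = 1"
    using in_mult_eq(1)[OF p] by simp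
  have w3: "in_w p * (1 - ?w * (?G * (in_w q * in_w ir))) = 1"
    using in_mult_eq(2)[OF p] by simp
  have qq1: "1 + fps_X * ?q1 = q"
    by (rule fps_ext) (auto simp: q(2))
  have z4: "1 + ?z * in_z ?q1 = in_z q" using arg_cong[OF qq1, of in_z] by simp
  have w4: "1 + ?w * in_w ?q1 = in_w q" using arg_cong[OF qq1, of in_w] by simp
  \<comment> \<open>\<open>f = p / r\<close>; its values at \<open>z\<close> and \<open>w\<close> are the common factors of both kernels.\<close>
  define f where "f = p * ir"
  have zf: "in_z f = in_z p * in_z ir" and wf: "in_w f = in_w p * in_w ir"
    by (simp_all add: f_def)
  have "hankel (fps_shift 1 p) = in_z f * in_w f *
     (?G * (?G * (in_z q * in_w q) + (1 - ?G) * hankel q))"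
  proof (rule hankel_shift_eqI)
    have "(?z - ?w) * (in_z f * in_w f * (?G * (?G * (in_z q * in_w q) + (1 - ?G) * hankel q)))
       = in_z f * in_w f * (?G * ((?z - ?w) * ?G * (in_z q * in_w q) + (1 - ?G) * ((?z - ?w) * hankel q)))"
      by algebra
    also have "\<dots> = in_z f * in_w f * (?G * ((?z - ?w) * ?G * (in_z q * in_w q)
        + (1 - ?G) * (?z * in_z q - ?w * in_w q)))"
      by (simp only: diff_mult_hankel)
    also have "\<dots> = in_z p - in_w p"
      unfolding zf wf using z1 w1 z2 w2 z3 w3 by algebra
    finally show "(?z - ?w) * (in_z f * in_w f * (?G * (?G * (in_z q * in_w q) + (1 - ?G) * hankel q)))
        = in_z p - in_w p" .
  qed
  moreover have "hankel (p - fps_shift 1 p) = in_z f * in_w f *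
     ((1 - ?G) * (1 + ?G * (in_z fps_X * in_w fps_X * hankel (fps_shift 1 (q - ?q1)))))"
  proof (rule hankel_diff_eqI)
    have "(?z - ?w) * (in_z f * in_w f *
       ((1 - ?G) * (1 + ?G * (in_z fps_X * in_w fps_X * hankel (fps_shift 1 (q - ?q1))))))
       = in_z f * in_w f *
       ((1 - ?G) * (?z - ?w + ?G * (?z * ?w * ((?z - ?w) * hankel (fps_shift 1 (q - ?q1))))))"
      unfolding in_z_hom by algebra
    also have "\<dots> = in_z f * in_w f *
       ((1 - ?G) * (?z - ?w + ?G * (?z * ?w * (in_z q - in_z ?q1 - (in_w q - in_w ?q1)))))"
      by (simp only: diff_mult_hankel_shift in_z_hom in_w_hom)
    also have "\<dots> = (?z - 1) * in_z p - (?w - 1) * in_w p"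
      unfolding zf wf using z1 w1 z2 w2 z3 w3 z4 w4 by algebra
    finally show "(?z - ?w) * (in_z f * in_w f *
       ((1 - ?G) * (1 + ?G * (in_z fps_X * in_w fps_X * hankel (fps_shift 1 (q - ?q1))))))
       = (?z - 1) * in_z p - (?w - 1) * in_w p" .
  qed
  moreover have "1 - ?G = in_w (fps_const (1 - g))"
    by (simp add: c)
  ultimately show ?thesis
    unfolding hausdorff_def using q g
    by (simp add: psd_scale_congruence psd_scale psd_add psd_one psd_rank_one hausdorff_hankel
        hausdorff_hankel_shift_diff del: One_nat_def in_z_hom)
qed

section \<open>Moment sequences as positive functionals\<close>

text \<open>Moments of \<open>(t + (1 - t))\<^sup>M = 1\<close>, expanded by the binomial theorem.\<close>
lemma hausdorff_binomial_weights:
  "(\<Sum>k\<le>M. real (M choose k) * fps_nth (((\<lambda>f. f - fps_shift 1 f) ^^ (M - k)) g) (k + n)) = fps_nth g n"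
proof (induction M arbitrary: n)
  case (Suc M)
  let ?D = "\<lambda>f :: real fps. f - fps_shift 1 f"
  have D: "fps_nth ((?D ^^ Suc m) g) j = fps_nth ((?D ^^ m) g) j - fps_nth ((?D ^^ m) g) (Suc j)" for m j
    by simp
  define T where "T m j = fps_nth ((?D ^^ m) g) j" for m j
  have T: "T (Suc m) j = T m j - T m (Suc j)" for m j
    unfolding T_def by (rule D)
  have "(\<Sum>k\<le>Suc M. real (Suc M choose k) * T (Suc M - k) (k + n))
      = T (Suc M) n + (\<Sum>k\<le>M. real (M choose k) * T (M - k) (Suc (k + n)))
        + (\<Sum>k\<le>M. real (M choose Suc k) * T (M - k) (Suc (k + n)))"
    by (simp add: sum.atMost_Suc_shift distrib_right sum.distrib del: sum.atMost_Suc)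
  \<comment> \<open>The summand with \<open>k = M\<close> vanishes, since \<open>M choose Suc M = 0\<close>.\<close>
  also have "(\<Sum>k\<le>M. real (M choose Suc k) * T (M - k) (Suc (k + n)))
      = (\<Sum>k<M. real (M choose Suc k) * T (Suc (M - Suc k)) (Suc k + n))"
    by (simp add: lessThan_Suc_atMost[symmetric] Suc_diff_Suc)
  also have "T (Suc M) n + (\<Sum>k\<le>M. real (M choose k) * T (M - k) (Suc (k + n))) + \<dots>
      = (\<Sum>k\<le>M. real (M choose k) * T (M - k) (Suc (k + n)))
       + (\<Sum>k\<le>M. real (M choose k) * T (Suc (M - k)) (k + n))"
    by (cases M) (simp_all add: sum.atMost_Suc_shift lessThan_Suc_atMost del: sum.atMost_Suc)
  also have "\<dots> = (\<Sum>k\<le>M. real (M choose k) * T (M - k) (k + n))"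
    by (simp add: T right_diff_distrib sum_subtractf)
  also have "\<dots> = fps_nth g n" unfolding T_def by (rule Suc.IH)
  finally show ?case unfolding T_def .
qed simp

text \<open>
  Sampling without replacement approaches sampling with replacement, at rate \<open>1 / N\<close> uniformly in the
  number \<open>k\<close> of marked objects. The bound on \<open>N\<close> keeps every factor in \<open>[-1,1]\<close>.
\<close>
lemma falling_ratio_approx:
  "\<exists>C. \<forall>N \<ge> 2 * n + 1. \<forall>k \<le> N. \<bar>(\<Prod>i<n. (real k - real i) / (real N - real i)) - (real k / real N) ^ n\<bar> \<le> C / real N"
proof (induction n)
  case 0
  then show ?case by (intro exI[of _ 0]) auto
next
  case (Suc n)
  then obtain C where C: "\<And>N k. N \<ge> 2 * n + 1 \<Longrightarrow> k \<le> N \<Longrightarrow>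
      \<bar>(\<Prod>i<n. (real k - real i) / (real N - real i)) - (real k / real N) ^ n\<bar> \<le> C / real N"
    by blast
  show ?case
  proof (intro exI[of _ "C + 2 * real n"] allI impI)
    fix N k :: nat assume N: "N \<ge> 2 * Suc n + 1" and k: "k \<le> N"
    define P where "P = (\<Prod>i<n. (real k - real i) / (real N - real i))"
    define q where "q = (real k - real n) / (real N - real n)"
    define y where "y = real k / real N"
    have N2: "real N \<ge> 2 * real n + 1" "real N - real n > 0" "real N > 0" using N by auto
    have PC: "\<bar>P - y ^ n\<bar> \<le> C / real N" using C[of N k] N k by (simp add: P_def y_def)
    have q1: "\<bar>q\<bar> \<le> 1"
      using N2 k by (auto simp: q_def abs_le_iff field_simps)
    have y01: "0 \<le> y" "y \<le> 1" using k N2 by (auto simp: y_def)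
    have "y - q = real n * (real N - real k) / (real N * (real N - real n))"
      using N2 by (simp add: y_def q_def field_simps)
    also have "\<dots> \<le> real n * real N / (real N * (real N - real n))"
      using N2 by (intro divide_right_mono mult_left_mono) auto
    also have "\<dots> = real n / (real N - real n)" using N2 by simp
    also have "\<dots> \<le> real n / (real N / 2)"
      using N2 by (intro divide_left_mono) auto
    finally have yq1: "y - q \<le> 2 * real n / real N" by (simp add: mult.commute)
    have "y - q = real n * (real N - real k) / (real N * (real N - real n))"
      using N2 by (simp add: y_def q_def field_simps)
    then have yq0: "0 \<le> y - q" using N2 k by simp
    have "\<bar>P * q - y ^ Suc n\<bar> = \<bar>(P - y ^ n) * q + y ^ n * (q - y)\<bar>"
      by (simp add: algebra_simps)
    also have "\<dots> \<le> \<bar>P - y ^ n\<bar> * \<bar>q\<bar> + y ^ n * \<bar>q - y\<bar>"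
      using y01 by (intro order_trans[OF abs_triangle_ineq]) (simp add: abs_mult)
    also have "\<dots> \<le> C / real N * 1 + 1 * (2 * real n / real N)"
      using PC q1 yq0 yq1 y01 by (intro add_mono mult_mono) (auto simp: power_le_one)
    finally show "\<bar>(\<Prod>i<Suc n. (real k - real i) / (real N - real i)) - (real k / real N) ^ Suc n\<bar>
        \<le> (C + 2 * real n) / real N"
      by (simp add: P_def q_def y_def add_divide_distrib)
  qed
qed

lemma binomial_falling:
  assumes "n \<le> N" "k \<le> N"
  shows "real (N choose k) * (\<Prod>i<n. (real k - real i) / (real N - real i))
       = (if n \<le> k then real ((N - n) choose (k - n)) else 0)"
  using assms(1)
proof (induction n)
  case (Suc n)
  then have IH: "real (N choose k) * (\<Prod>i<n. (real k - real i) / (real N - real i))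
       = (if n \<le> k then real ((N - n) choose (k - n)) else 0)" and n: "n < N" by auto
  have "real (N choose k) * (\<Prod>i<Suc n. (real k - real i) / (real N - real i))
     = (if n \<le> k then real ((N - n) choose (k - n)) else 0) * ((real k - real n) / (real N - real n))"
    by (simp flip: IH)
  also have "\<dots> = (if Suc n \<le> k then real ((N - Suc n) choose (k - Suc n)) else 0)"
  proof (cases "Suc n \<le> k")
    case True
    then obtain l where l: "k = Suc n + l" using le_Suc_ex by blast
    obtain m where m: "N = Suc n + m" using n less_iff_Suc_add by auto
    have "real (Suc l) * real (Suc m choose Suc l) = real (Suc m) * real (m choose l)"
      using Suc_times_binomial[of l m] by (metis of_nat_mult)
    then show ?thesis by (simp add: l m field_simps del: binomial_Suc_Suc)
  qed (auto simp: not_less_eq_eq)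
  finally show ?case .
qed simp

text \<open>
  Bernstein weights \<open>w N k = (N choose k) \<integral> t\<^sup>k (1 - t)\<^sup>N\<^sup>-\<^sup>k\<close> at the nodes \<open>k / N\<close> define discrete
  positive measures. Their moments converge to the coefficients of \<open>g\<close>, because the exact moment
  formula has falling factorials in place of powers. A series that is nonnegative on \<open>[0,1]\<close> has a
  nonnegative integral against each of them, and Tannery's theorem gives the limit.
\<close>
lemma hausdorff_positive:
  fixes h :: "nat \<Rightarrow> real"
  assumes g: "hausdorff g" and h: "summable (\<lambda>n. \<bar>h n\<bar>)"
    and pos: "\<And>t. 0 \<le> t \<Longrightarrow> t \<le> 1 \<Longrightarrow> 0 \<le> (\<Sum>n. h n * t ^ n)"
  shows "0 \<le> (\<Sum>n. h n * fps_nth g n)"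
proof -
  let ?D = "\<lambda>f :: real fps. f - fps_shift 1 f"
  define w where "w N k = real (N choose k) * fps_nth ((?D ^^ (N - k)) g) k" for N k
  define m where "m N n = (\<Sum>k\<le>N. w N k * (real k / real N) ^ n)" for N n
  have iter: "hausdorff ((?D ^^ l) g)" for l
    by (induction l) (simp_all add: g hausdorff_diff_shift del: One_nat_def)
  have w0: "0 \<le> w N k" for N k
    unfolding w_def by (intro mult_nonneg_nonneg hausdorff_nth_nonneg iter) auto
  have sumw: "(\<Sum>k\<le>N. w N k) = fps_nth g 0" for N
    using hausdorff_binomial_weights[of N g 0] by (simp add: w_def)
  have exact: "(\<Sum>k\<le>N. w N k * (\<Prod>i<n. (real k - real i) / (real N - real i))) = fps_nth g n"
    if "n \<le> N" for n N
  proof -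
    have "(\<Sum>k\<le>N. w N k * (\<Prod>i<n. (real k - real i) / (real N - real i)))
      = (\<Sum>k\<le>N. (if n \<le> k then real ((N - n) choose (k - n)) else 0) * fps_nth ((?D ^^ (N - k)) g) k)"
      using binomial_falling[OF that] by (intro sum.cong) (auto simp: w_def mult_ac)
    also have "\<dots> = (\<Sum>k\<in>{n..N}. real ((N - n) choose (k - n)) * fps_nth ((?D ^^ (N - k)) g) k)"
      by (intro sum.mono_neutral_cong_right) auto
    also have "\<dots> = (\<Sum>k\<le>N - n. real ((N - n) choose k) * fps_nth ((?D ^^ (N - n - k)) g) (k + n))"
      using that
      by (intro sum.reindex_bij_witness[of _ "\<lambda>k. k + n" "\<lambda>k. k - n"]) auto
    also have "\<dots> = fps_nth g n" by (rule hausdorff_binomial_weights)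
    finally show ?thesis .
  qed
  have lim: "(\<lambda>N. m N n) \<longlonglongrightarrow> fps_nth g n" for n
  proof -
    obtain C where C: "\<And>N k. N \<ge> 2 * n + 1 \<Longrightarrow> k \<le> N \<Longrightarrow>
      \<bar>(\<Prod>i<n. (real k - real i) / (real N - real i)) - (real k / real N) ^ n\<bar> \<le> C / real N"
      using falling_ratio_approx[of n] by blast
    have bd: "norm (m N n - fps_nth g n) \<le> fps_nth g 0 * C * (1 / real N)" if "N \<ge> 2 * n + 1" for N
    proof -
      have "m N n - fps_nth g n
          = (\<Sum>k\<le>N. w N k * ((real k / real N) ^ n - (\<Prod>i<n. (real k - real i) / (real N - real i))))"
        using exact[of n N] that by (simp add: m_def right_diff_distrib sum_subtractf)
      also have "norm \<dots> \<le> (\<Sum>k\<le>N. w N k * (C / real N))"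
      proof (rule order_trans[OF norm_sum sum_mono])
        fix k assume "k \<in> {..N}"
        then show "norm (w N k * ((real k / real N) ^ n - (\<Prod>i<n. (real k - real i) / (real N - real i))))
            \<le> w N k * (C / real N)"
          using mult_left_mono[OF C[OF that, of k] w0[of N k]] w0[of N k]
          by (simp only: atMost_iff real_norm_def abs_mult abs_of_nonneg abs_minus_commute)
      qed
      also have "\<dots> = fps_nth g 0 * C * (1 / real N)"
        by (simp add: sumw flip: sum_distrib_right sum_divide_distrib)
      finally show ?thesis .
    qed
    have "(\<lambda>N. fps_nth g 0 * C * (1 / real N)) \<longlonglongrightarrow> fps_nth g 0 * C * 0"
      by (intro tendsto_intros lim_1_over_n)
    then have null: "(\<lambda>N. fps_nth g 0 * C * (1 / real N)) \<longlonglongrightarrow> 0"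
      by (simp only: mult_zero_right)
    have "eventually (\<lambda>N. norm (m N n - fps_nth g n) \<le> fps_nth g 0 * C * (1 / real N)) sequentially"
      using eventually_ge_at_top[of "2 * n + 1"] by eventually_elim (rule bd)
    from Lim_null_comparison[OF this null] have "(\<lambda>N. m N n - fps_nth g n) \<longlonglongrightarrow> 0" .
    then show ?thesis by (simp add: LIM_zero_iff)
  qed
  have mbd: "\<bar>m N n\<bar> \<le> fps_nth g 0" for N n
  proof -
    have "\<bar>m N n\<bar> = (\<Sum>k\<le>N. w N k * (real k / real N) ^ n)"
      unfolding m_def by (intro abs_of_nonneg sum_nonneg) (simp add: w0)
    also have "\<dots> \<le> (\<Sum>k\<le>N. w N k * 1)"
      by (intro sum_mono mult_left_mono power_le_one w0) (auto simp: divide_le_eq)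
    finally show ?thesis by (simp add: sumw)
  qed
  have lim2: "(\<lambda>N. \<Sum>n. h n * m N n) \<longlonglongrightarrow> (\<Sum>n. h n * fps_nth g n)"
  proof -
    have "eventually (\<lambda>(k, n). norm (h k * m n k) \<le> \<bar>h k\<bar> * fps_nth g 0) (at_top \<times>\<^sub>F sequentially)"
      by (intro always_eventually) (auto simp: abs_mult intro!: mult_left_mono mbd)
    moreover have "(\<lambda>N. h n * m N n) \<longlonglongrightarrow> h n * fps_nth g n" for n
      by (intro tendsto_intros lim)
    ultimately show ?thesis
      using tannerys_theorem[of "\<lambda>n N. h n * m N n" "\<lambda>n. h n * fps_nth g n" sequentially
        "\<lambda>n. \<bar>h n\<bar> * fps_nth g 0"] summable_mult2[OF h, of "fps_nth g 0"]
      by simp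
  qed
  have sum_t: "summable (\<lambda>n. h n * t ^ n)" if "0 \<le> t" "t \<le> 1" for t
  proof (rule summable_comparison_test'[OF h, of 0])
    fix n show "norm (h n * t ^ n) \<le> \<bar>h n\<bar>"
      using that by (simp add: abs_mult mult_left_le power_le_one)
  qed
  have "0 \<le> (\<Sum>n. h n * m N n)" for N
  proof -
    have fr: "0 \<le> real k / real N" "real k / real N \<le> 1" if "k \<le> N" for k
      using that by (auto simp: divide_le_eq)
    have "0 \<le> (\<Sum>k\<le>N. w N k * (\<Sum>n. h n * (real k / real N) ^ n))"
      using fr by (intro sum_nonneg mult_nonneg_nonneg w0 pos) auto
    also have "\<dots> = (\<Sum>k\<le>N. (\<Sum>n. w N k * (h n * (real k / real N) ^ n)))"
      using fr by (intro sum.cong refl suminf_mult[symmetric] sum_t) auto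
    also have "\<dots> = (\<Sum>n. (\<Sum>k\<le>N. w N k * (h n * (real k / real N) ^ n)))"
      using fr by (intro suminf_sum[symmetric] summable_mult sum_t) auto
    also have "\<dots> = (\<Sum>n. h n * m N n)"
      by (simp add: m_def sum_distrib_left mult_ac)
    finally show ?thesis .
  qed
  then show ?thesis by (intro LIMSEQ_le_const[OF lim2]) auto
qed

section \<open>Quotients of contiguous hypergeometric series\<close>

definition hyp_fps :: "real \<Rightarrow> real \<Rightarrow> real \<Rightarrow> real fps" where
  "hyp_fps a b c = Abs_fps (\<lambda>n. pochhammer a n * pochhammer b n / (pochhammer c n * fact n))"

lemma hyp_fps_nth: "fps_nth (hyp_fps a b c) n = pochhammer a n * pochhammer b n / (pochhammer c n * fact n)"
  by (simp add: hyp_fps_def)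

lemma hyp_fps_0 [simp]: "fps_nth (hyp_fps a b c) 0 = 1"
  by (simp add: hyp_fps_nth)

lemma hyp_fps_commute: "hyp_fps a b c = hyp_fps b a c"
  by (simp add: hyp_fps_def mult.commute)

lemma pochhammer_plus_one: "(a :: real) * pochhammer (a + 1) n = pochhammer a n * (a + real n)"
  by (metis pochhammer_Suc pochhammer_rec)

lemma hyp_fps_Suc:
  assumes "0 < c"
  shows "fps_nth (hyp_fps a b c) (Suc n) * ((c + real n) * (real n + 1))
       = fps_nth (hyp_fps a b c) n * ((a + real n) * (b + real n))"
proof -
  have "pochhammer c n > 0" "c + real n > 0" "real n + 1 > 0"
    using assms by (auto intro: pochhammer_pos)
  then show ?thesis
    by (simp add: hyp_fps_nth pochhammer_Suc divide_simps)
qed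

lemma hyp_fps_upper: "a * fps_nth (hyp_fps (a + 1) b c) n = fps_nth (hyp_fps a b c) n * (a + real n)"
  using pochhammer_plus_one[of a n] by (simp add: hyp_fps_nth mult_ac)

lemma hyp_fps_contiguous_a:
  assumes "0 < c"
  shows "hyp_fps a b c = hyp_fps (a + 1) b c - fps_X * (fps_const (b / c) * hyp_fps (a + 1) (b + 1) (c + 1))"
proof (rule fps_ext)
  fix n
  show "fps_nth (hyp_fps a b c) n =
    fps_nth (hyp_fps (a + 1) b c - fps_X * (fps_const (b / c) * hyp_fps (a + 1) (b + 1) (c + 1))) n"
  proof (cases n)
    case (Suc m)
    have pos: "pochhammer (c + 1) m > 0" "real m + 1 > 0"
      using assms by (auto intro: pochhammer_pos)
    have "pochhammer (a + 1) (Suc m) = pochhammer (a + 1) m * (a + 1 + real m)"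
      by (rule pochhammer_Suc)
    then show ?thesis
      using pos assms
      by (simp add: Suc hyp_fps_nth pochhammer_rec[of a] pochhammer_rec[of b] pochhammer_rec[of c] divide_simps)
         (simp add: algebra_simps)
  qed simp
qed

lemma hyp_fps_contiguous_bc:
  assumes "0 < c"
  shows "hyp_fps a b c = fps_const (1 - b / c) * hyp_fps a b (c + 1) + fps_const (b / c) * hyp_fps a (b + 1) (c + 1)"
proof (rule fps_ext)
  fix n
  have pos: "pochhammer c n > 0" "pochhammer (c + 1) n > 0" "c + real n > 0"
    using assms by (auto intro: pochhammer_pos)
  have c1: "pochhammer (c + 1) n = pochhammer c n * (c + real n) / c"
    using pochhammer_plus_one[of c n] assms by (simp add: field_simps)
  have "(1 - b / c) * pochhammer b n + (b / c) * pochhammer (b + 1) n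
      = pochhammer b n * (c + real n) / c"
    using pochhammer_plus_one[of b n] assms by (simp add: divide_simps) (simp add: algebra_simps)
  then have "pochhammer a n * ((1 - b / c) * pochhammer b n + (b / c) * pochhammer (b + 1) n)
      / (pochhammer (c + 1) n * fact n)
      = pochhammer a n * (pochhammer b n * (c + real n) / c) / (pochhammer (c + 1) n * fact n)"
    by simp
  also have "\<dots> = fps_nth (hyp_fps a b c) n"
    using pos assms by (simp add: c1 hyp_fps_nth)
  finally show "fps_nth (hyp_fps a b c) n = fps_nth (fps_const (1 - b / c) * hyp_fps a b (c + 1)
      + fps_const (b / c) * hyp_fps a (b + 1) (c + 1)) n"
    by (simp add: hyp_fps_nth algebra_simps add_divide_distrib diff_divide_distrib)
qed

text \<open>
  The factor \<open>1 - z\<close> in this relation is what cancels the pole at \<open>1\<close> of the logarithmic derivative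
  when \<open>c \<ge> a + b + 1\<close>.
\<close>
lemma hyp_fps_contiguous_ab:
  assumes "0 < a" "0 < b" "0 < c"
  shows "fps_const (c - a - 1) * hyp_fps a b c
    = fps_const b * ((1 - fps_X) * hyp_fps (a + 1) (b + 1) c) + fps_const (c - a - 1 - b) * hyp_fps (a + 1) b c"
proof (rule fps_ext)
  fix n
  show "fps_nth (fps_const (c - a - 1) * hyp_fps a b c) n = fps_nth (fps_const b * ((1 - fps_X) * hyp_fps (a + 1) (b + 1) c)
      + fps_const (c - a - 1 - b) * hyp_fps (a + 1) b c) n"
  proof (cases n)
    case (Suc m)
    define G where "G = fps_nth (hyp_fps a b c) (Suc m)"
    define T where "T = fps_nth (hyp_fps a b c) m"
    have rec: "T * ((a + real m) * (b + real m)) = G * ((c + real m) * (real m + 1))"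
      using hyp_fps_Suc[OF assms(3), of a b m] by (simp add: G_def T_def)
    have F10: "fps_nth (hyp_fps (a + 1) b c) (Suc m) = G * (a + real m + 1) / a"
      using hyp_fps_upper[of a b c "Suc m"] assms by (simp add: G_def field_simps)
    have F10': "fps_nth (hyp_fps (a + 1) b c) m = T * (a + real m) / a"
      using hyp_fps_upper[of a b c m] assms by (simp add: T_def field_simps)
    have F11: "b * fps_nth (hyp_fps (a + 1) (b + 1) c) k = fps_nth (hyp_fps (a + 1) b c) k * (b + real k)" for k
      using hyp_fps_upper[of b "a + 1" c k] by (simp add: hyp_fps_commute[of _ "a + 1"])
    have key: "(c - a - 1) * G = G * (a + real m + 1) / a * (b + real m + 1) - T * (a + real m) / a * (b + real m)
        + (c - a - 1 - b) * (G * (a + real m + 1) / a)"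
    proof -
      have "a * ((c - a - 1) * G) = G * (a + real m + 1) * (b + real m + 1) - T * ((a + real m) * (b + real m))
        + (c - a - 1 - b) * (G * (a + real m + 1))"
        unfolding rec by (simp add: algebra_simps)
      then show ?thesis using assms(1) by (simp add: divide_simps) (simp add: algebra_simps)
    qed
    have t1: "b * fps_nth (hyp_fps (a + 1) (b + 1) c) (Suc m) = G * (a + real m + 1) / a * (b + real m + 1)"
      unfolding F11 F10 by (simp add: add.assoc add.commute)
    have t2: "b * fps_nth (hyp_fps (a + 1) (b + 1) c) m = T * (a + real m) / a * (b + real m)"
      unfolding F11 F10' ..
    have "fps_nth (fps_const b * ((1 - fps_X) * hyp_fps (a + 1) (b + 1) c)
        + fps_const (c - a - 1 - b) * hyp_fps (a + 1) b c) (Suc m)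
      = b * fps_nth (hyp_fps (a + 1) (b + 1) c) (Suc m) - b * fps_nth (hyp_fps (a + 1) (b + 1) c) m
        + (c - a - 1 - b) * fps_nth (hyp_fps (a + 1) b c) (Suc m)"
      by (simp add: left_diff_distrib right_diff_distrib)
    then show ?thesis
      unfolding Suc t1 t2 F10 using key by (simp add: G_def)
  qed simp
qed

lemma hyp_fps_theta:
  "fps_X * fps_deriv (hyp_fps a b c) = fps_const a * (hyp_fps (a + 1) b c - hyp_fps a b c)"
proof (rule fps_ext)
  fix n
  have "fps_nth (fps_X * fps_deriv (hyp_fps a b c)) n = real n * fps_nth (hyp_fps a b c) n"
    by (cases n) auto
  then show "fps_nth (fps_X * fps_deriv (hyp_fps a b c)) n
      = fps_nth (fps_const a * (hyp_fps (a + 1) b c - hyp_fps a b c)) n"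
    using hyp_fps_upper[of a b c n] by (simp add: algebra_simps)
qed

lemma hyp_fps_ode:
  assumes "0 < c"
  defines "\<theta> \<equiv> \<lambda>f. fps_X * fps_deriv f"
  shows "(1 - fps_X) * \<theta> (\<theta> (hyp_fps a b c)) =
    (fps_const (a + b) * fps_X - fps_const (c - 1)) * \<theta> (hyp_fps a b c) + fps_const (a * b) * fps_X * hyp_fps a b c"
proof (rule fps_ext)
  fix n
  let ?F = "hyp_fps a b c"
  have th: "fps_nth (\<theta> f) n = real n * fps_nth f n" for f n
    unfolding \<theta>_def by (cases n) auto
  show "fps_nth ((1 - fps_X) * \<theta> (\<theta> ?F)) n =
    fps_nth ((fps_const (a + b) * fps_X - fps_const (c - 1)) * \<theta> ?F + fps_const (a * b) * fps_X * ?F) n"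
    using hyp_fps_Suc[OF assms(1), of a b "n - 1"]
    by (cases n) (simp_all add: th left_diff_distrib mult.assoc, simp add: algebra_simps)
qed

definition hyp_ratio :: "real \<Rightarrow> real \<Rightarrow> real \<Rightarrow> real fps" where
  "hyp_ratio a b c = hyp_fps (a + 1) b c * inverse (hyp_fps a b c)"

lemma hyp_ratio_mult: "hyp_ratio a b c * hyp_fps a b c = hyp_fps (a + 1) b c"
  by (simp add: hyp_ratio_def mult.assoc inverse_mult_eq_1)

lemma hyp_ratio_0 [simp]: "fps_nth (hyp_ratio a b c) 0 = 1"
  by (simp add: hyp_ratio_def)

lemma fps_inverse_ex:
  assumes "fps_nth (f :: real fps) 0 = 1"
  obtains g where "f * g = 1" "fps_nth g 0 = 1"
  using assms by (metis inverse_mult_eq_1' fps_mult_nth_0 fps_one_nth mult_1 zero_neq_one)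

text \<open>
  The first contiguous relation gives \<open>F(a,b;c) / F(a+1,b;c) = 1 - z g F(a+1,b+1;c+1) / F(a+1,b;c)\<close>
  with \<open>g = b / c\<close>. The second one expresses the denominator \<open>F(a+1,b;c)\<close> through the two series that
  form the quotient with parameters \<open>(b, a + 1, c + 1)\<close>. The exchange of \<open>a\<close> and \<open>b\<close> makes the next
  parameter \<open>(a + 1) / (c + 1)\<close>, again a number in \<open>[0,1]\<close>.
\<close>
lemma hyp_ratio_step:
  assumes "0 < c" and g: "g = b / c" and r: "r = fps_const (1 - g) + fps_const g * hyp_ratio b (a + 1) (c + 1)"
    and ir: "r * ir = 1"
  shows "hyp_ratio a b c * (1 - fps_X * (fps_const g * (hyp_ratio b (a + 1) (c + 1) * ir))) = 1"
proof -
  define F where "F = hyp_fps a b c"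
  define F1 where "F1 = hyp_fps (a + 1) b c"
  define Q where "Q = hyp_fps b (a + 1) (c + 1)"
  define Q1 where "Q1 = hyp_fps (b + 1) (a + 1) (c + 1)"
  have q: "hyp_ratio b (a + 1) (c + 1) * Q = Q1"
    unfolding Q_def Q1_def by (rule hyp_ratio_mult)
  have p: "hyp_ratio a b c * F = F1"
    unfolding F_def F1_def by (rule hyp_ratio_mult)
  have e1: "F = F1 - fps_X * (fps_const g * Q1)"
    unfolding F_def F1_def Q1_def g hyp_fps_commute[of "b + 1"]
    by (rule hyp_fps_contiguous_a[OF assms(1)])
  have "F1 = fps_const (1 - g) * Q + fps_const g * Q1"
    unfolding F1_def Q_def Q1_def g hyp_fps_commute[of _ "a + 1" "c + 1"]
    by (rule hyp_fps_contiguous_bc[OF assms(1)])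
  then have e2: "r * Q = F1"
    unfolding r by (simp add: distrib_right mult.assoc q)
  have "F1 \<noteq> 0"
  proof
    assume "F1 = 0"
    then have "fps_nth F1 0 = 0" by simp
    then show False by (simp add: F1_def)
  qed
  moreover have "F1 * (hyp_ratio a b c * (1 - fps_X * (fps_const g * (hyp_ratio b (a + 1) (c + 1) * ir)))) = F1 * 1"
  proof -
    have qir: "F1 * (hyp_ratio b (a + 1) (c + 1) * ir) = Q1"
    proof -
      have "F1 * (hyp_ratio b (a + 1) (c + 1) * ir) = (hyp_ratio b (a + 1) (c + 1) * Q) * (r * ir)"
        by (simp only: e2[symmetric] mult_ac)
      then show ?thesis by (simp add: q ir)
    qed
    have "F1 * (hyp_ratio a b c * (1 - fps_X * (fps_const g * (hyp_ratio b (a + 1) (c + 1) * ir))))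
        = hyp_ratio a b c * (F1 - fps_X * (fps_const g * (F1 * (hyp_ratio b (a + 1) (c + 1) * ir))))"
      by (simp add: algebra_simps)
    then show ?thesis unfolding qir e1[symmetric] p by simp
  qed
  ultimately show ?thesis by (metis mult_left_cancel)
qed

text \<open>
  Two applications of the continued fraction step differ by \<open>z\<close> times a multiple of the difference of
  their arguments, so truncating the continued fraction one level later improves the agreement by one
  power of \<open>z\<close>.
\<close>
lemma hyp_ratio_approximants:
  assumes "0 \<le> a" "a \<le> c" "0 \<le> b" "b \<le> c" "0 < c"
  shows "\<exists>P. hausdorff P \<and> fps_nth P 0 = 1 \<and> fps_X ^ Suc n dvd P - hyp_ratio a b c"
  using assms
proof (induction n arbitrary: a b c)
  case 0
  have "hyp_ratio a b c = 1 + fps_X * fps_shift 1 (hyp_ratio a b c)"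
    by (rule fps_ext) auto
  then have "1 - hyp_ratio a b c = fps_X ^ Suc 0 * (- fps_shift 1 (hyp_ratio a b c))"
    by (simp add: algebra_simps)
  then show ?case
    using hausdorff_one by (intro exI[of _ 1]) auto
next
  case (Suc n)
  define q where "q = hyp_ratio b (a + 1) (c + 1)"
  define g where "g = b / c"
  have g01: "0 \<le> g" "g \<le> 1" using Suc.prems by (auto simp: g_def)
  from Suc.IH[of b "c + 1" "a + 1"] Suc.prems obtain Q where
    Q: "hausdorff Q" "fps_nth Q 0 = 1" "fps_X ^ Suc n dvd Q - q"
    by (auto simp: q_def)
  define r where "r = fps_const (1 - g) + fps_const g * q"
  define R where "R = fps_const (1 - g) + fps_const g * Q"
  have "fps_nth r 0 = 1" by (simp add: r_def q_def)
  then obtain ir where ir: "r * ir = 1" by (rule fps_inverse_ex)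
  have "fps_nth R 0 = 1" by (simp add: R_def Q)
  then obtain iR where iR: "R * iR = 1" by (rule fps_inverse_ex)
  obtain P where P: "(1 - fps_X * (fps_const g * (Q * iR))) * P = 1" "fps_nth P 0 = 1"
    by (rule fps_inverse_ex[of "1 - fps_X * (fps_const g * (Q * iR))"]) auto
  have hP: "hausdorff P"
    by (rule hausdorff_gauss_step[OF Q(1,2) g01 R_def iR]) (use P(1) in \<open>simp add: mult.commute\<close>)
  have p: "hyp_ratio a b c * (1 - fps_X * (fps_const g * (q * ir))) = 1"
    unfolding q_def
    by (rule hyp_ratio_step[OF Suc.prems(5) g_def]) (use ir in \<open>simp_all add: r_def q_def\<close>)
  have c1: "fps_const (1 - g) = 1 - fps_const g" by (simp add: fps_eq_iff)
  have "P - hyp_ratio a b c =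
     fps_X * (fps_const g * fps_const (1 - g) * P * hyp_ratio a b c * iR * ir * (Q - q))"
    using P(1) p ir iR r_def R_def c1 by algebra
  moreover have "fps_X * fps_X ^ Suc n dvd
     fps_X * (fps_const g * fps_const (1 - g) * P * hyp_ratio a b c * iR * ir * (Q - q))"
    using Q(3) by (intro mult_dvd_mono dvd_mult) auto
  ultimately show ?case using hP P(2) by (auto simp only: power_Suc)
qed

lemma hausdorff_hyp_ratio:
  assumes "0 \<le> a" "a \<le> c" "0 \<le> b" "b \<le> c" "0 < c"
  shows "hausdorff (hyp_ratio a b c)"
proof (rule hausdorff_limit)
  fix n
  obtain P d where P: "hausdorff P" "P - hyp_ratio a b c = fps_X ^ Suc n * d"
    using hyp_ratio_approximants[OF assms, of n] by (auto elim!: dvdE)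
  have "fps_nth P k = fps_nth (hyp_ratio a b c) k" if "k \<le> n" for k
  proof -
    have "fps_nth (P - hyp_ratio a b c) k = 0"
      unfolding P(2) using that by (simp add: fps_X_power_mult_nth del: power_Suc)
    then show ?thesis by simp
  qed
  then show "\<exists>h. hausdorff h \<and> (\<forall>k\<le>n. fps_nth h k = fps_nth (hyp_ratio a b c) k)"
    using P(1) by blast
qed

section \<open>The logarithmic derivative of the derivative\<close>

lemma shift_plus: "fps_nth (f :: real fps) 0 = 1 \<Longrightarrow> 1 + fps_X * fps_shift 1 f = f"
  by (rule fps_ext) auto

lemma hausdorff_const_affine:
  assumes "hausdorff f" "0 \<le> s" "0 \<le> t"
  shows "hausdorff (fps_const s + fps_const t * f)"
  using hausdorff_add[OF hausdorff_scale[OF hausdorff_one assms(2)] hausdorff_scale[OF assms(1,3)]]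
  by simp

text \<open>
  Here \<open>r = f' / F = 1 + \<omega>\<close>, \<open>u = 1 / r\<close> and \<open>v = u / (1 - z)\<close>. The identity asserted for \<open>R\<close> is the
  differential equation for \<open>F\<close>, rewritten as an equation for \<open>z R = z f'' / f'\<close>. It is solved by
  \<open>z R = (a b - \<delta>) z / (1 - z) + \<delta> (v - 1) + \<beta> (1 - u)\<close>, where every term is a nonnegative multiple
  of \<open>z\<close> times a hausdorff series.
\<close>
lemma log_derivative_small_c:
  assumes pos: "0 < a" "a < 1" "0 < b" "b \<le> 1" "a \<le> c" "b \<le> c"
    and c: "1 + a + b - a * b \<le> c" "c \<le> a + b + 1"
  defines "\<omega> \<equiv> fps_const a * (hyp_ratio a b c - 1)"
  shows "\<exists>R. hausdorff R \<and> (1 - fps_X) * (fps_X * R) * (1 + \<omega>) =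
      (fps_const (2 - c) + fps_const (a + b - 1) * fps_X) * \<omega> + fps_const (a * b) * fps_X"
proof -
  define r where "r = fps_const (1 - a) + fps_const a * hyp_ratio a b c"
  have r\<omega>: "r = 1 + \<omega>"
    by (simp add: r_def \<omega>_def right_diff_distrib flip: fps_const_sub fps_const_1_eq_1)
  have hr: "hausdorff r"
    unfolding r_def using pos by (intro hausdorff_const_affine hausdorff_hyp_ratio) auto
  have r0: "fps_nth r 0 = 1" by (simp add: r_def)
  then obtain u where u: "r * u = 1" "fps_nth u 0 = 1" by (rule fps_inverse_ex)
  define v where "v = u * geom"
  have hv: "hausdorff v" unfolding v_def by (rule hausdorff_dual[OF hr u(1)])
  have hu: "hausdorff (- fps_shift 1 u)" by (rule hausdorff_inverse_shift[OF hr r0 u(1)])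
  have v0: "fps_nth v 0 = 1" by (simp add: v_def geom_def u)
  have v: "(1 - fps_X) * v = u" unfolding v_def using geom_mult by algebra
  define d where "d = c - 1 - a - b + a * b"
  define R where "R = fps_const (a * b - d) * geom + fps_const d * fps_shift 1 v
      + fps_const ((1 - a) * (1 - b)) * (- fps_shift 1 u)"
  have "0 \<le> d" "0 \<le> a * b - d" "0 \<le> (1 - a) * (1 - b)" using c pos by (auto simp: d_def)
  then have "hausdorff R"
    unfolding R_def by (intro hausdorff_add hausdorff_scale hausdorff_geom hausdorff_shift hv hu)
  moreover have "(1 - fps_X) * (fps_X * R) * (1 + \<omega>) =
      (fps_const (2 - c) + fps_const (a + b - 1) * fps_X) * \<omega> + fps_const (a * b) * fps_X"
  proof -
    define A where "A = fps_const a"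
    define B where "B = fps_const b"
    define C where "C = fps_const c"
    note su = shift_plus[OF u(2)] and sv = shift_plus[OF v0]
    have scalars: "fps_const d = C - 1 - A - B + A * B" "fps_const ((1 - a) * (1 - b)) = (1 - A) * (1 - B)"
      "fps_const (a * b - d) = 1 + A + B - C" "fps_const (2 - c) = 2 - C" "fps_const (a + b - 1) = A + B - 1"
      "fps_const (a * b) = A * B"
      by (simp_all add: fps_eq_iff fps_numeral_nth fps_const_mult[symmetric] A_def B_def C_def d_def
          algebra_simps del: fps_const_mult)
    show ?thesis
      unfolding R_def scalars using r\<omega> u(1) v su sv geom_mult by algebra
  qed
  ultimately show ?thesis by blast
qed

text \<open>
  The first term of \<open>z R = a b (y - 1) + \<beta> (1 - u)\<close> involves \<open>y = F(a+1,b+1;c) / f'\<close>. By the contiguous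
  relation \<open>y = 1 / (s (1 - z) + (1 - s) / p3)\<close> with \<open>s = (1 - a) b / (c - a - 1)\<close> in \<open>[0,1]\<close>, and
  \<open>p3 = F(a+1,b+1;c) / F(a+1,b;c)\<close> is hausdorff since \<open>a + 1 \<le> c\<close>. Two applications of duality,
  separated by forming a convex combination with \<open>1\<close>, lead from \<open>p3\<close> to \<open>y\<close>.
\<close>
lemma log_derivative_large_c:
  assumes pos: "0 < a" "a < 1" "0 < b" "b \<le> 1"
    and c: "a + b + 1 \<le> c"
  defines "\<omega> \<equiv> fps_const a * (hyp_ratio a b c - 1)"
  shows "\<exists>R. hausdorff R \<and> (1 - fps_X) * (fps_X * R) * (1 + \<omega>) =
      (fps_const (2 - c) + fps_const (a + b - 1) * fps_X) * \<omega> + fps_const (a * b) * fps_X"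
proof -
  define p where "p = hyp_ratio a b c"
  define p3 where "p3 = hyp_ratio b (a + 1) c"
  define e where "e = c - a - 1"
  have e: "e > 0" "b \<le> e" using pos c by (auto simp: e_def)
  define s where "s = (1 - a) * b / e"
  have "(1 - a) * b \<le> 1 * e" using pos e by (intro mult_mono) auto
  \<comment> \<open>The bound \<open>b \<le> c - a - 1\<close> is what makes \<open>s\<close> a convex coefficient.\<close>
  then have s: "0 \<le> s" "s \<le> 1" using pos e by (auto simp: s_def)
  define r where "r = fps_const (1 - a) + fps_const a * hyp_ratio a b c"
  have r\<omega>: "r = 1 + \<omega>"
    by (simp add: r_def \<omega>_def right_diff_distrib flip: fps_const_sub fps_const_1_eq_1)
  have hr: "hausdorff r"
    unfolding r_def using pos c by (intro hausdorff_const_affine hausdorff_hyp_ratio) auto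
  have r0: "fps_nth r 0 = 1" by (simp add: r_def)
  then obtain u where u: "r * u = 1" "fps_nth u 0 = 1" by (rule fps_inverse_ex)
  have hu: "hausdorff (- fps_shift 1 u)" by (rule hausdorff_inverse_shift[OF hr r0 u(1)])

  have hp3: "hausdorff p3"
    unfolding p3_def using pos c by (intro hausdorff_hyp_ratio) auto
  have "fps_nth p3 0 = 1" by (simp add: p3_def)
  then obtain u3 where u3: "p3 * u3 = 1" "fps_nth u3 0 = 1" by (rule fps_inverse_ex)
  define v3 where "v3 = u3 * geom"
  have hv3: "hausdorff v3" unfolding v3_def by (rule hausdorff_dual[OF hp3 u3(1)])
  have v3: "(1 - fps_X) * v3 = u3" unfolding v3_def using geom_mult by algebra
  define r4 where "r4 = fps_const s + fps_const (1 - s) * v3"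
  have hr4: "hausdorff r4" unfolding r4_def using s by (intro hausdorff_const_affine hv3) auto
  have "fps_nth r4 0 = 1" by (simp add: r4_def v3_def geom_def u3)
  then obtain u4 where u4: "r4 * u4 = 1" "fps_nth u4 0 = 1" by (rule fps_inverse_ex)
  define y where "y = u4 * geom"
  have hy: "hausdorff y" unfolding y_def by (rule hausdorff_dual[OF hr4 u4(1)])
  have y: "(1 - fps_X) * y = u4" unfolding y_def using geom_mult by algebra
  have y0: "fps_nth y 0 = 1" by (simp add: y_def geom_def u4)

  define R where "R = fps_const (a * b) * fps_shift 1 y + fps_const ((1 - a) * (1 - b)) * (- fps_shift 1 u)"
  have "0 \<le> a * b" "0 \<le> (1 - a) * (1 - b)" using pos by auto
  then have "hausdorff R"
    unfolding R_def by (intro hausdorff_add hausdorff_scale hausdorff_shift hy hu)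
  moreover have "(1 - fps_X) * (fps_X * R) * (1 + \<omega>) =
      (fps_const (2 - c) + fps_const (a + b - 1) * fps_X) * \<omega> + fps_const (a * b) * fps_X"
  proof -
    define A where "A = fps_const a"
    define B where "B = fps_const b"
    define C where "C = fps_const c"
    define E where "E = fps_const e"
    define S where "S = fps_const s"
    note su = shift_plus[OF u(2)] and sy = shift_plus[OF y0]
    have scalars: "fps_const ((1 - a) * (1 - b)) = (1 - A) * (1 - B)"
      "fps_const (2 - c) = 2 - C" "fps_const (a + b - 1) = A + B - 1"
      "fps_const (a * b) = A * B"
      by (simp_all add: fps_eq_iff fps_numeral_nth fps_const_mult[symmetric] A_def B_def C_def
          algebra_simps del: fps_const_mult)
    have Ee: "E = C - A - 1" by (simp add: E_def e_def A_def C_def fps_eq_iff)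
    have ES: "E * S = (1 - A) * B"
    proof -
      have "E * S = fps_const (e * s)" by (simp add: E_def S_def)
      also have "e * s = (1 - a) * b" using e by (simp add: s_def)
      also have "fps_const \<dots> = (1 - A) * B"
        by (simp add: A_def B_def fps_const_mult[symmetric] fps_eq_iff algebra_simps del: fps_const_mult)
      finally show ?thesis .
    qed
    have En: "E \<noteq> 0" using e by (simp add: E_def)
    have "fps_const (1 - s) = 1 - S" "fps_const (1 - a) = 1 - A"
      by (simp_all add: S_def A_def fps_eq_iff)
    then have r4: "r4 = S + (1 - S) * v3" and rA: "r = 1 - A + A * p"
      by (simp_all add: r4_def S_def r_def A_def p_def)
    have contig: "E = B * ((1 - fps_X) * (p3 * p)) + (E - B) * p"
    proof -
      let ?F = "hyp_fps a b c"
      have p3F: "p3 * (p * ?F) = hyp_fps (a + 1) (b + 1) c"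
        using hyp_ratio_mult[of b "a + 1" c] hyp_ratio_mult[of a b c]
        by (simp add: p_def p3_def hyp_fps_commute[of "a + 1"])
      have pF: "p * ?F = hyp_fps (a + 1) b c"
        using hyp_ratio_mult[of a b c] by (simp add: p_def)
      have "E * ?F = B * ((1 - fps_X) * hyp_fps (a + 1) (b + 1) c) + (E - B) * hyp_fps (a + 1) b c"
        using hyp_fps_contiguous_ab[OF pos(1,3), of c] c pos by (simp add: E_def B_def e_def)
      then have "?F * E = ?F * (B * ((1 - fps_X) * (p3 * p)) + (E - B) * p)"
        unfolding p3F[symmetric] pF[symmetric] by algebra
      moreover have "?F \<noteq> 0"
      proof
        assume "?F = 0"
        then have "fps_nth ?F 0 = 0" by simp
        then show False by simp
      qed
      ultimately show ?thesis by (metis mult_left_cancel)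
    qed
    \<comment> \<open>This says that \<open>y = F(a+1,b+1;c) / f'\<close>, because \<open>p p3 F = F(a+1,b+1;c)\<close> and \<open>r F = f'\<close>.\<close>
    have "E * (y * r) = E * (p * p3)"
    proof -
      have "y * (S * (1 - fps_X) + (1 - S) * u3) = 1"
        using u4(1) y v3 r4 by algebra
      then have y3: "y * (S * (1 - fps_X) * p3 + (1 - S)) = p3"
        using u3(1) by algebra
      have "E * r = E * (S * (1 - fps_X) * p3 + (1 - S)) * p"
        using contig ES rA by algebra
      then show ?thesis using y3 by algebra
    qed
    then have yr: "y * r = p * p3" using En by simp
    show ?thesis
      unfolding R_def scalars using r\<omega> u(1) su sy yr contig Ee rA by algebra
  qed
  ultimately show ?thesis by blast
qed

text \<open>
  The identity characterising \<open>R\<close> in the two preceding lemmas, multiplied by \<open>F\<close>, is the differential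
  equation for \<open>F\<close>; comparing the two shows that \<open>R\<close> is the logarithmic derivative of \<open>f'\<close>.
\<close>
lemma hausdorff_log_derivative:
  assumes pos: "0 < a" "a < 1" "0 < b" "b \<le> 1" "a \<le> c" "b \<le> c"
    and c: "1 + a + b - a * b \<le> c"
  defines "\<omega> \<equiv> fps_const a * (hyp_ratio a b c - 1)"
    and "h \<equiv> fps_deriv (fps_X * hyp_fps a b c)"
  obtains R where "hausdorff R" "fps_deriv h = R * h"
    "(1 - fps_X) * (fps_X * R) * (1 + \<omega>) =
      (fps_const (2 - c) + fps_const (a + b - 1) * fps_X) * \<omega> + fps_const (a * b) * fps_X"
proof -
  obtain R where R: "hausdorff R" "(1 - fps_X) * (fps_X * R) * (1 + \<omega>) =
      (fps_const (2 - c) + fps_const (a + b - 1) * fps_X) * \<omega> + fps_const (a * b) * fps_X"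
    using log_derivative_small_c[OF pos c] log_derivative_large_c[OF pos(1-4)]
    unfolding \<omega>_def by (metis linear)
  let ?F = "hyp_fps a b c" and ?X = "fps_X :: real fps"
  define \<theta> where "\<theta> = ?X * fps_deriv ?F"
  have th: "\<theta> = \<omega> * ?F"
    unfolding \<theta>_def \<omega>_def hyp_fps_theta hyp_ratio_mult[symmetric] by algebra
  have h: "h = (1 + \<omega>) * ?F"
    by (simp add: h_def th[symmetric] \<theta>_def distrib_right)
  have h': "?X * fps_deriv h = \<theta> + ?X * fps_deriv \<theta>"
    by (simp add: h_def \<theta>_def algebra_simps)
  have ode: "(1 - ?X) * (?X * fps_deriv \<theta>) =
      (fps_const (a + b) * ?X - fps_const (c - 1)) * \<theta> + fps_const (a * b) * ?X * ?F"
    unfolding \<theta>_def using hyp_fps_ode[of c a b] pos by simp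
  have scalars: "fps_const (2 - c) = 1 - fps_const (c - 1)" "fps_const (a + b - 1) = fps_const (a + b) - 1"
    by (simp_all add: fps_eq_iff)
  have "((1 - ?X) * ?X) * fps_deriv h = ((1 - ?X) * ?X) * (R * h)"
    using R(2) h h' ode th unfolding scalars by algebra
  moreover have "(1 - ?X) * ?X \<noteq> 0"
  proof
    assume "(1 - ?X) * ?X = 0"
    then have "fps_nth ((1 - ?X) * ?X) 1 = 0" by simp
    then show False by simp
  qed
  ultimately have "fps_deriv h = R * h" by (metis mult_left_cancel)
  with R show ?thesis using that by blast
qed

section \<open>Values in the unit disc\<close>

abbreviation disc_fps :: "'a :: {banach, real_normed_field} fps \<Rightarrow> bool" where
  "disc_fps f \<equiv> 1 \<le> fps_conv_radius f"

text \<open>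
  Evaluation of a series is multiplicative only inside the disc of convergence; bounded
  coefficients provide the unit disc.
\<close>
lemma disc_fps_bounded:
  fixes f :: "'a :: {banach, real_normed_field} fps"
  assumes "\<And>n. norm (fps_nth f n) \<le> C"
  shows "disc_fps f"
  unfolding fps_conv_radius_def
proof (rule conv_radius_geI_ex')
  fix r :: real assume r: "0 < r" "ereal r < 1"
  show "summable (\<lambda>n. fps_nth f n * of_real r ^ n)"
  proof (rule summable_comparison_test'[of "\<lambda>n. C * r ^ n" 0])
    show "summable (\<lambda>n. C * r ^ n)" using r by (intro summable_mult summable_geometric) auto
    show "norm (fps_nth f n * of_real r ^ n) \<le> C * r ^ n" for n
      using r assms by (simp add: norm_mult norm_power mult_right_mono)
  qed
qed

lemma disc_fps_mult: "disc_fps f \<Longrightarrow> disc_fps g \<Longrightarrow> disc_fps (f * g)"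
  and disc_fps_add: "disc_fps f \<Longrightarrow> disc_fps g \<Longrightarrow> disc_fps (f + g)"
  and disc_fps_diff: "disc_fps f \<Longrightarrow> disc_fps g \<Longrightarrow> disc_fps (f - g)"
  using fps_conv_radius_mult[of f g] fps_conv_radius_add[of f g] fps_conv_radius_diff[of f g]
  by (auto simp: min_def split: if_splits intro: order_trans)

lemma disc_fps_normD: "disc_fps f \<Longrightarrow> norm z < 1 \<Longrightarrow> ereal (norm z) < fps_conv_radius f"
  by (rule less_le_trans[of _ "1 :: ereal"]) auto

definition fps_complex :: "real fps \<Rightarrow> complex fps" where
  "fps_complex g = Abs_fps (\<lambda>n. complex_of_real (fps_nth g n))"

lemma fps_complex_nth [simp]: "fps_nth (fps_complex g) n = complex_of_real (fps_nth g n)"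
  by (simp add: fps_complex_def)

lemma fps_complex_mult: "fps_complex (f * g) = fps_complex f * fps_complex g"
  by (rule fps_ext) (simp add: fps_mult_nth)

lemma fps_complex_deriv: "fps_complex (fps_deriv f) = fps_deriv (fps_complex f)"
  by (rule fps_ext) simp

lemma fps_complex_X: "fps_complex fps_X = fps_X"
  by (rule fps_ext) auto

lemma hausdorff_disc:
  assumes "hausdorff g"
  shows "disc_fps g" "disc_fps (fps_complex g)"
  using hausdorff_nth_nonneg[OF assms] hausdorff_nth_le[OF assms]
  by (auto intro!: disc_fps_bounded[of _ "fps_nth g 0"])

text \<open>
  Over the common denominator \<open>|1 - t z|\<^sup>2 (1 + x t)\<close> the numerator is
  \<open>x + Re z - t (|z|\<^sup>2 + x Re z)\<close>, which is at least \<open>(x + Re z) (1 - t x)\<close>.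
\<close>
lemma Re_kernel_nonneg:
  fixes z :: complex and x t :: real
  assumes z: "norm z \<le> x" and x: "x < 1" and t: "0 \<le> t" "t \<le> 1"
  shows "0 \<le> Re (z / (1 - of_real t * z)) + x / (1 + x * t)"
proof -
  have x0: "0 \<le> x" using norm_ge_zero[of z] z by linarith
  define D where "D = (cmod (1 - of_real t * z))\<^sup>2"
  have D_eq: "D = 1 - 2 * t * Re z + t\<^sup>2 * (cmod z)\<^sup>2"
    unfolding D_def cmod_power2 by (simp add: power2_eq_square algebra_simps)
  have "norm (of_real t * z) < 1"
    using t z x by (simp add: norm_mult) (metis le_less_trans mult_left_le_one_le norm_ge_zero)
  then have "1 - of_real t * z \<noteq> 0" by auto
  then have D: "D > 0" by (simp add: D_def)
  have Re_eq: "Re (z / (1 - of_real t * z)) = (Re z - t * (cmod z)\<^sup>2) / D"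
    unfolding D_def cmod_power2 by (simp add: Re_divide power2_eq_square algebra_simps)
  have Rex: "\<bar>Re z\<bar> \<le> x" using abs_Re_le_cmod[of z] z by linarith
  have "(cmod z)\<^sup>2 \<le> x\<^sup>2" using z by (intro power_mono) auto
  then have "t * ((cmod z)\<^sup>2 + x * Re z) \<le> t * (x\<^sup>2 + x * Re z)"
    using t by (intro mult_left_mono) auto
  moreover have "0 \<le> (x + Re z) * (1 - t * x)"
    using Rex x t x0 by (intro mult_nonneg_nonneg) (auto simp: mult_le_one)
  ultimately have num: "0 \<le> (Re z - t * (cmod z)\<^sup>2) * (1 + x * t) + x * D"
    unfolding D_eq by (simp add: algebra_simps power2_eq_square)
  have xt: "1 + x * t > 0" using x0 t by (simp add: add_pos_nonneg)
  have "Re (z / (1 - of_real t * z)) + x / (1 + x * t)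
      = ((Re z - t * (cmod z)\<^sup>2) * (1 + x * t) + x * D) / (D * (1 + x * t))"
    unfolding Re_eq using D xt by (simp add: add_frac_eq)
  also have "\<dots> \<ge> 0" using num D xt by simp
  finally show ?thesis .
qed

text \<open>The previous inequality for the kernels \<open>z / (1 - t z)\<close>, integrated over \<open>t\<close>.\<close>
lemma hausdorff_Re_ge:
  assumes g: "hausdorff g" and z: "norm z \<le> x" and x: "x < 1"
  shows "- x * eval_fps g (- x) \<le> Re (z * eval_fps (fps_complex g) z)"
proof -
  have x0: "0 \<le> x" using norm_ge_zero[of z] z by linarith
  define h where "h n = Re (z ^ Suc n) + x * (- x) ^ n" for n
  have "summable (\<lambda>n. \<bar>h n\<bar>)"
  proof (rule summable_comparison_test'[of "\<lambda>n. 2 * x ^ n" 0])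
    show "summable (\<lambda>n. 2 * x ^ n)" using x x0 by (intro summable_mult summable_geometric) auto
    fix n
    have "\<bar>Re (z ^ Suc n)\<bar> \<le> norm z ^ Suc n"
      using abs_Re_le_cmod[of "z ^ Suc n"] by (simp only: norm_power)
    also have "\<dots> \<le> x ^ Suc n" using z by (intro power_mono) auto
    also have "\<dots> \<le> x ^ n" using x x0 by (simp add: mult_left_le_one_le)
    finally have "\<bar>Re (z ^ Suc n)\<bar> \<le> x ^ n" .
    moreover have "\<bar>x * (- x) ^ n\<bar> \<le> x ^ n"
      using x x0 by (simp add: abs_mult power_abs mult_left_le_one_le)
    ultimately show "norm \<bar>h n\<bar> \<le> 2 * x ^ n" unfolding h_def by simp
  qed
  moreover have "0 \<le> (\<Sum>n. h n * t ^ n)" if t: "0 \<le> t" "t \<le> 1" for t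
  proof -
    have "norm (of_real t * z) < 1"
      using t z x by (simp add: norm_mult) (metis le_less_trans mult_left_le_one_le norm_ge_zero)
    then have "(\<lambda>n. z * (of_real t * z) ^ n) sums (z * (1 / (1 - of_real t * z)))"
      by (intro sums_mult geometric_sums)
    then have "(\<lambda>n. Re (z * (of_real t * z) ^ n)) sums Re (z * (1 / (1 - of_real t * z)))"
      by (rule sums_Re)
    moreover have "\<bar>x * t\<bar> < 1" using x x0 t by (simp add: abs_mult) (metis le_less_trans mult_left_le)
    then have "(\<lambda>n. x * (- (x * t)) ^ n) sums (x * (1 / (1 - (- (x * t)))))"
      by (intro sums_mult geometric_sums) simp
    ultimately have "(\<lambda>n. Re (z * (of_real t * z) ^ n) + x * (- (x * t)) ^ n) sums
        (Re (z * (1 / (1 - of_real t * z))) + x * (1 / (1 - (- (x * t)))))"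
      by (rule sums_add)
    also have "(\<lambda>n. Re (z * (of_real t * z) ^ n) + x * (- (x * t)) ^ n) = (\<lambda>n. h n * t ^ n)"
    proof
      fix n
      have "z * (of_real t * z) ^ n = of_real (t ^ n) * z ^ Suc n"
        by (simp add: power_mult_distrib)
      then have "Re (z * (of_real t * z) ^ n) = t ^ n * Re (z ^ Suc n)"
        by (simp only: Re_complex_of_real Im_complex_of_real times_complex.sel)
      moreover have "(- (x * t)) ^ n = (- x) ^ n * t ^ n"
        by (simp flip: power_mult_distrib)
      ultimately show "Re (z * (of_real t * z) ^ n) + x * (- (x * t)) ^ n = h n * t ^ n"
        by (simp add: h_def algebra_simps)
    qed
    finally have "(\<Sum>n. h n * t ^ n) = Re (z / (1 - of_real t * z)) + x / (1 + x * t)"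
      by (simp add: sums_iff)
    then show ?thesis using Re_kernel_nonneg[OF z x t] by simp
  qed
  ultimately have "0 \<le> (\<Sum>n. h n * fps_nth g n)"
    by (rule hausdorff_positive[OF g])
  also have "(\<lambda>n. h n * fps_nth g n) sums (Re (z * eval_fps (fps_complex g) z) + x * eval_fps g (- x))"
  proof -
    have "(\<lambda>n. fps_nth (fps_complex g) n * z ^ n) sums eval_fps (fps_complex g) z"
      using z x by (intro sums_eval_fps disc_fps_normD hausdorff_disc g) auto
    then have "(\<lambda>n. Re (z * (fps_nth (fps_complex g) n * z ^ n))) sums Re (z * eval_fps (fps_complex g) z)"
      by (intro sums_Re sums_mult)
    moreover have "(\<lambda>n. fps_nth g n * (- x) ^ n) sums eval_fps g (- x)"
      using x x0 by (intro sums_eval_fps disc_fps_normD hausdorff_disc g) auto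
    then have "(\<lambda>n. x * (fps_nth g n * (- x) ^ n)) sums (x * eval_fps g (- x))"
      by (rule sums_mult)
    ultimately have "(\<lambda>n. Re (z * (fps_nth (fps_complex g) n * z ^ n)) + x * (fps_nth g n * (- x) ^ n)) sums
        (Re (z * eval_fps (fps_complex g) z) + x * eval_fps g (- x))"
      by (rule sums_add)
    also have "(\<lambda>n. Re (z * (fps_nth (fps_complex g) n * z ^ n)) + x * (fps_nth g n * (- x) ^ n))
        = (\<lambda>n. h n * fps_nth g n)"
    proof
      fix n
      have "z * (fps_nth (fps_complex g) n * z ^ n) = of_real (fps_nth g n) * z ^ Suc n" by simp
      then have "Re (z * (fps_nth (fps_complex g) n * z ^ n)) = fps_nth g n * Re (z ^ Suc n)"
        by (simp only: Re_complex_of_real Im_complex_of_real times_complex.sel)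
      then show "Re (z * (fps_nth (fps_complex g) n * z ^ n)) + x * (fps_nth g n * (- x) ^ n) = h n * fps_nth g n"
        by (simp add: h_def algebra_simps)
    qed
    finally show ?thesis .
  qed
  then have "(\<Sum>n. h n * fps_nth g n) = Re (z * eval_fps (fps_complex g) z) + x * eval_fps g (- x)"
    by (simp add: sums_iff)
  finally show ?thesis by simp
qed

text \<open>Integration of \<open>1 / (1 + x) \<le> 1 / (1 + x t) \<le> 1\<close>.\<close>
lemma hausdorff_real_bounds:
  assumes g: "hausdorff g" and x: "0 \<le> x" "x < 1"
  shows "fps_nth g 0 / (1 + x) \<le> eval_fps g (- x)" "eval_fps g (- x) \<le> fps_nth g 0"
proof -
  have sx: "summable (\<lambda>n. x ^ n)" using x by (intro summable_geometric) auto
  have fin: "summable (\<lambda>n :: nat. if n = 0 then d else 0)" for d :: real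
    by (rule summable_single)
  have geo: "(\<lambda>n. (- x) ^ n * t ^ n) sums (1 / (1 + x * t))" if "0 \<le> t" "t \<le> 1" for t
  proof -
    have "x * t < 1" using x that by (metis le_less_trans mult_left_le)
    then have "(\<lambda>n. (- (x * t)) ^ n) sums (1 / (1 - (- (x * t))))"
      using x that by (intro geometric_sums) simp
    then show ?thesis by (simp flip: power_mult_distrib)
  qed
  have ev: "(\<lambda>n. fps_nth g n * (- x) ^ n) sums eval_fps g (- x)"
    using x by (intro sums_eval_fps disc_fps_normD hausdorff_disc g) auto
  have single: "(\<lambda>n :: nat. (if n = 0 then d else 0) * f n) sums (d * f 0)" for d and f :: "nat \<Rightarrow> real"
    using sums_single[of 0 "\<lambda>n. d * f n"] by (simp add: if_distrib[of "\<lambda>x. x * _"] cong: if_cong)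
  \<comment> \<open>Both bounds integrate an inequality of the form \<open>0 \<le> \<alpha> / (1 + x t) + d\<close>.\<close>
  have main: "0 \<le> \<alpha> * eval_fps g (- x) + d * fps_nth g 0"
    if "\<And>t. 0 \<le> t \<Longrightarrow> t \<le> 1 \<Longrightarrow> 0 \<le> \<alpha> / (1 + x * t) + d" for \<alpha> d
  proof -
    define h where "h n = \<alpha> * (- x) ^ n + (if n = 0 then d else 0)" for n :: nat
    have "summable (\<lambda>n. \<bar>h n\<bar>)"
    proof (rule summable_comparison_test'[of "\<lambda>n. \<bar>\<alpha>\<bar> * x ^ n + (if n = 0 then \<bar>d\<bar> else 0)" 0])
      show "summable (\<lambda>n. \<bar>\<alpha>\<bar> * x ^ n + (if n = 0 then \<bar>d\<bar> else 0))"
        by (intro summable_add summable_mult sx fin)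
      show "norm \<bar>h n\<bar> \<le> \<bar>\<alpha>\<bar> * x ^ n + (if n = 0 then \<bar>d\<bar> else 0)" for n
        using x abs_triangle_ineq[of "\<alpha> * (- x) ^ n" d] by (auto simp: h_def abs_mult power_abs)
    qed
    moreover have "0 \<le> (\<Sum>n. h n * t ^ n)" if t: "0 \<le> t" "t \<le> 1" for t
    proof -
      have "(\<lambda>n. \<alpha> * ((- x) ^ n * t ^ n) + (if n = 0 then d else 0) * t ^ n) sums (\<alpha> * (1 / (1 + x * t)) + d * t ^ 0)"
        by (intro sums_add sums_mult geo t single)
      then have "(\<Sum>n. h n * t ^ n) = \<alpha> / (1 + x * t) + d"
        by (simp add: sums_iff h_def algebra_simps)
      then show ?thesis using \<open>\<And>t. 0 \<le> t \<Longrightarrow> t \<le> 1 \<Longrightarrow> 0 \<le> \<alpha> / (1 + x * t) + d\<close>[OF t] by simp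
    qed
    ultimately have "0 \<le> (\<Sum>n. h n * fps_nth g n)"
      by (rule hausdorff_positive[OF g])
    moreover have "(\<lambda>n. \<alpha> * (fps_nth g n * (- x) ^ n) + (if n = 0 then d else 0) * fps_nth g n) sums
        (\<alpha> * eval_fps g (- x) + d * fps_nth g 0)"
      by (intro sums_add sums_mult ev single)
    then have "(\<Sum>n. h n * fps_nth g n) = \<alpha> * eval_fps g (- x) + d * fps_nth g 0"
      by (simp add: sums_iff h_def algebra_simps)
    ultimately show ?thesis by simp
  qed
  have "0 \<le> 1 * eval_fps g (- x) + (- (1 / (1 + x))) * fps_nth g 0"
  proof (rule main)
    fix t :: real assume "0 \<le> t" "t \<le> 1"
    then have "1 / (1 + x) \<le> 1 / (1 + x * t)"
      using x by (intro divide_left_mono) (auto simp: mult_left_le intro!: mult_pos_pos add_pos_nonneg)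
    then show "0 \<le> 1 / (1 + x * t) + - (1 / (1 + x))" by simp
  qed
  then show "fps_nth g 0 / (1 + x) \<le> eval_fps g (- x)" by simp
  have "0 \<le> (- 1) * eval_fps g (- x) + 1 * fps_nth g 0"
  proof (rule main)
    fix t :: real assume "0 \<le> t" "t \<le> 1"
    then have "1 / (1 + x * t) \<le> 1" using x by (simp add: divide_le_eq add_pos_nonneg)
    then show "0 \<le> - 1 / (1 + x * t) + 1" by simp
  qed
  then show "eval_fps g (- x) \<le> fps_nth g 0" by simp
qed

lemma hyp_ratio_1:
  assumes "0 < c" "0 < a"
  shows "fps_nth (hyp_ratio a b c) 1 = b / c"
proof -
  have "fps_nth (hyp_ratio a b c * hyp_fps a b c) 1 = fps_nth (hyp_fps (a + 1) b c) 1"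
    by (simp only: hyp_ratio_mult)
  then show ?thesis using assms
    by (simp add: fps_mult_nth hyp_fps_nth field_simps)
qed

text \<open>
  Writing the quotient as \<open>p = 1 + z p1\<close> and as \<open>1 / p = 1 - z s\<close>, both \<open>p1\<close> and \<open>s\<close> are hausdorff with
  constant term \<open>b / c\<close>. The lower bound for \<open>p1(-x)\<close> bounds \<open>p(-x)\<close> from above, and the upper bound for
  \<open>s(-x)\<close> bounds it from below, as Jensen's inequality would.
\<close>
lemma hyp_ratio_bounds:
  assumes pos: "0 < a" "0 < b" "a \<le> c" "b \<le> c" and x: "0 \<le> x" "x < 1"
  shows "c / (c + b * x) \<le> eval_fps (hyp_ratio a b c) (- x)"
    and "eval_fps (hyp_ratio a b c) (- x) \<le> 1 - b / c * x / (1 + x)"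
proof -
  let ?p = "hyp_ratio a b c"
  have hp: "hausdorff ?p" using pos by (intro hausdorff_hyp_ratio) auto
  obtain u where u: "?p * u = 1" "fps_nth u 0 = 1" using fps_inverse_ex[of ?p] by auto
  define p1 where "p1 = fps_shift 1 ?p"
  define s where "s = - fps_shift 1 u"
  have hp1: "hausdorff p1" unfolding p1_def by (rule hausdorff_shift[OF hp])
  have hs: "hausdorff s" unfolding s_def by (rule hausdorff_inverse_shift[OF hp _ u(1)]) simp
  have p10: "fps_nth p1 0 = b / c" using hyp_ratio_1[of c a b] pos by (simp add: p1_def)
  have "fps_nth (?p * u) 1 = 0" by (simp add: u(1))
  then have s0: "fps_nth s 0 = b / c"
    using hyp_ratio_1[of c a b] pos by (simp add: s_def fps_mult_nth u(2))
  have nx: "norm (- x) < 1" using x by simp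
  note conv = disc_fps_normD[OF _ nx, simplified]
  have pe: "?p = 1 + fps_X * p1" by (rule fps_ext) (auto simp: p1_def)
  have "eval_fps ?p (- x) = 1 + (- x) * eval_fps p1 (- x)"
    unfolding pe using hausdorff_disc(1)[OF hp1]
    by (simp add: eval_fps_add eval_fps_mult conv disc_fps_mult)
  moreover have "b / c / (1 + x) \<le> eval_fps p1 (- x)"
    using hausdorff_real_bounds(1)[OF hp1 x] p10 by simp
  ultimately show "eval_fps ?p (- x) \<le> 1 - b / c * x / (1 + x)"
    using mult_left_mono[of "b / c / (1 + x)" "eval_fps p1 (- x)" x] x by (simp add: mult_ac)
  have ue: "u = 1 - fps_X * s" by (rule fps_ext) (auto simp: s_def u(2))
  have ux: "eval_fps u (- x) = 1 + x * eval_fps s (- x)"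
    unfolding ue using hausdorff_disc(1)[OF hs]
    by (simp add: eval_fps_diff eval_fps_mult conv disc_fps_mult)
  have "disc_fps u" unfolding ue using hausdorff_disc(1)[OF hs]
    by (intro disc_fps_diff disc_fps_mult) auto
  then have px: "eval_fps ?p (- x) * (1 + x * eval_fps s (- x)) = 1"
    using hausdorff_disc(1)[OF hp] by (simp add: conv u(1) flip: eval_fps_mult ux)
  have "0 \<le> b / c / (1 + x)" using pos x by auto
  also have "\<dots> \<le> eval_fps s (- x)"
    using hausdorff_real_bounds(1)[OF hs x] s0 by simp
  finally have pos1: "1 + x * eval_fps s (- x) > 0" using x by (simp add: add_pos_nonneg)
  have le: "1 + x * eval_fps s (- x) \<le> 1 + x * (b / c)"
    using mult_left_mono[OF hausdorff_real_bounds(2)[OF hs x] x(1)] unfolding s0 by linarith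
  have pu: "eval_fps ?p (- x) = 1 / (1 + x * eval_fps s (- x))"
    using px pos1 by (simp add: eq_divide_eq)
  have "c / (c + b * x) = 1 / (1 + x * (b / c))" using pos x by (simp add: field_simps)
  also have "\<dots> \<le> eval_fps ?p (- x)"
    unfolding pu using le pos1 by (intro divide_left_mono) auto
  finally show "c / (c + b * x) \<le> eval_fps ?p (- x)" .
qed

section \<open>The order of convexity\<close>

text \<open>
  Since \<open>a \<le> c\<close> and \<open>b \<le> 1\<close>, each factor of \<open>(a)\<^sub>n (b)\<^sub>n\<close> is dominated by the corresponding factor of
  \<open>(c)\<^sub>n n!\<close>.
\<close>
lemma disc_fps_hyp:
  assumes "0 < a" "a \<le> c" "0 < b" "b \<le> 1"
  shows "disc_fps (fps_complex (hyp_fps a b c))"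
proof -
  have "\<bar>fps_nth (hyp_fps a b c) n\<bar> \<le> 1" for n
  proof -
    have pc: "pochhammer c n > 0" using assms by (intro pochhammer_pos) auto
    have "pochhammer a n \<le> pochhammer c n" "pochhammer b n \<le> pochhammer 1 n"
      unfolding pochhammer_prod using assms by (auto intro!: prod_mono)
    moreover have "0 \<le> pochhammer a n" "0 \<le> pochhammer b n"
      using assms by (auto intro!: less_imp_le[OF pochhammer_pos])
    ultimately have "pochhammer a n * pochhammer b n \<le> pochhammer c n * fact n"
      using pc by (intro mult_mono) (auto simp: pochhammer_fact)
    then show ?thesis
      using pc \<open>0 \<le> pochhammer a n\<close> \<open>0 \<le> pochhammer b n\<close> by (simp add: hyp_fps_nth abs_mult divide_le_eq)
  qed
  then show ?thesis
    by (auto intro!: disc_fps_bounded[of _ 1])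
qed

text \<open>
  The value of \<open>z f'' / f'\<close> at \<open>z = - x\<close>, as a function of the value \<open>\<omega>\<close> of \<open>z F' / F\<close> at that point.
\<close>
definition boundary_profile :: "real \<Rightarrow> real \<Rightarrow> real \<Rightarrow> real \<Rightarrow> real \<Rightarrow> real" where
  "boundary_profile a b c x \<omega> = ((2 - c - (a + b - 1) * x) * \<omega> - a * b * x) / ((1 + x) * (1 + \<omega>))"

lemma boundary_profile_diff:
  assumes "0 \<le> x" "1 + \<omega> > 0" "1 + \<omega>' > 0"
  shows "boundary_profile a b c x \<omega> - boundary_profile a b c x \<omega>'
       = (2 - c + (1 - a) * (1 - b) * x) * (\<omega> - \<omega>') / ((1 + x) * (1 + \<omega>) * (1 + \<omega>'))"
proof -
  have "1 + x \<noteq> 0" "1 + \<omega> \<noteq> 0" "1 + \<omega>' \<noteq> 0" using assms by auto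
  then show ?thesis
    unfolding boundary_profile_def by (simp add: divide_simps) (simp add: algebra_simps)
qed

lemma boundary_profile_eq:
  assumes pos: "0 < a" "a < 1" "0 < b" "b \<le> 1" "a \<le> c" "b \<le> c" and x: "0 \<le> x" "x < 1"
    and R: "hausdorff R" "(1 - fps_X) * (fps_X * R) * (1 + \<omega>) =
      (fps_const (2 - c) + fps_const (a + b - 1) * fps_X) * \<omega> + fps_const (a * b) * fps_X"
    and \<omega>: "\<omega> = fps_const a * (hyp_ratio a b c - 1)"
  shows "\<exists>w. - a * b * x / (c + b * x) \<le> w \<and> w \<le> - a * b / c * x / (1 + x)
    \<and> - x * eval_fps R (- x) = boundary_profile a b c x w"
proof -
  let ?p = "hyp_ratio a b c"
  define w where "w = a * (eval_fps ?p (- x) - 1)"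
  have hp: "hausdorff ?p" using pos by (intro hausdorff_hyp_ratio) auto
  have nx: "norm (- x) < 1" using x by simp
  note conv = disc_fps_normD[OF _ nx]
  note dp = hausdorff_disc(1)[OF hp] and dR = hausdorff_disc(1)[OF R(1)]
  have ev: "eval_fps (f + g) (- x) = eval_fps f (- x) + eval_fps g (- x)"
      "eval_fps (f - g) (- x) = eval_fps f (- x) - eval_fps g (- x)"
      "eval_fps (f * g) (- x) = eval_fps f (- x) * eval_fps g (- x)"
    if "disc_fps f" "disc_fps g" for f g
    using that by (auto intro!: eval_fps_add eval_fps_diff eval_fps_mult conv)
  note disc = disc_fps_add disc_fps_diff disc_fps_mult
  have d\<omega>: "disc_fps \<omega>" unfolding \<omega> using dp by (intro disc) auto
  have ew: "eval_fps \<omega> (- x) = w"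
    unfolding \<omega> w_def using dp by (simp add: ev disc)
  have "eval_fps ((1 - fps_X) * (fps_X * R) * (1 + \<omega>)) (- x) = (1 + x) * (- x * eval_fps R (- x)) * (1 + w)"
    using dR d\<omega> by (simp add: ev disc ew)
  moreover have "eval_fps ((fps_const (2 - c) + fps_const (a + b - 1) * fps_X) * \<omega> + fps_const (a * b) * fps_X) (- x)
      = (2 - c - (a + b - 1) * x) * w - a * b * x"
    using d\<omega> by (simp add: ev disc ew)
  ultimately have eq: "(1 + x) * (- x * eval_fps R (- x)) * (1 + w) = (2 - c - (a + b - 1) * x) * w - a * b * x"
    using R(2) by simp
  have lo: "- a * b * x / (c + b * x) \<le> w"
  proof -
    have "c + b * x > 0" using pos x by (intro add_pos_nonneg) auto
    then have "- a * b * x / (c + b * x) = a * (c / (c + b * x) - 1)"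
      by (simp add: field_simps)
    also have "\<dots> \<le> w"
      unfolding w_def using hyp_ratio_bounds(1)[OF pos(1,3,5,6) x] pos by (intro mult_left_mono) auto
    finally show ?thesis .
  qed
  have hi: "w \<le> - a * b / c * x / (1 + x)"
  proof -
    have "w \<le> a * ((1 - b / c * x / (1 + x)) - 1)"
      unfolding w_def using hyp_ratio_bounds(2)[OF pos(1,3,5,6) x] pos by (intro mult_left_mono) auto
    then show ?thesis by simp
  qed
  have "eval_fps ?p (- x) > 0"
    using hyp_ratio_bounds(1)[OF pos(1,3,5,6) x] pos x
    by (meson add_pos_nonneg divide_pos_pos less_imp_le less_le_trans mult_nonneg_nonneg)
  then have "a * eval_fps ?p (- x) > 0" using pos by simp
  then have "1 + w > 0" using pos by (simp add: w_def algebra_simps)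
  then have "- x * eval_fps R (- x) = boundary_profile a b c x w"
    using eq x unfolding boundary_profile_def by (simp add: eq_divide_eq mult_ac)
  then show ?thesis using lo hi by blast
qed

text \<open>
  The profile is monotone in \<open>\<omega>\<close>, with direction given by the sign of \<open>2 - c + (1 - a) (1 - b) x\<close>. The
  worst \<open>\<omega>\<close> is thus one end of the interval allowed by the bounds for the hypergeometric quotient. At
  \<open>x = 1\<close> the sign changes exactly at \<open>c = 3 - a - b + a b\<close>.
\<close>
lemma boundary_profile_lower:
  assumes pos: "0 < a" "a < 1" "0 < b" "b \<le> 1" "a \<le> c" "b \<le> c" and x: "0 \<le> x" "x < 1"
    and w: "- a * b * x / (c + b * x) \<le> w" "w \<le> - a * b / c * x / (1 + x)"
  shows "3 - a - b + a * b \<le> c \<Longrightarrow>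
      boundary_profile a b c x (- a * b / c * x / (1 + x)) \<le> boundary_profile a b c x w"
    and "c - 2 \<le> (1 - a) * (1 - b) * x \<Longrightarrow>
      boundary_profile a b c x (- a * b * x / (c + b * x)) \<le> boundary_profile a b c x w"
proof -
  have "b * x / (c + b * x) \<le> 1" using pos x by (simp add: divide_le_eq add_pos_nonneg)
  then have "a * (b * x / (c + b * x)) \<le> a * 1" using pos by (intro mult_left_mono) auto
  then have lo: "1 + - a * b * x / (c + b * x) > 0" using pos by simp
  then have w1: "1 + w > 0" "1 + - a * b / c * x / (1 + x) > 0" using w by auto
  have x1: "1 + x > 0" using x by simp
  show "boundary_profile a b c x (- a * b / c * x / (1 + x)) \<le> boundary_profile a b c x w"
    if c: "3 - a - b + a * b \<le> c"
  proof -
    have "(1 - a) * (1 - b) * x \<le> (1 - a) * (1 - b) * 1"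
      using pos x by (intro mult_left_mono) auto
    then have "2 - c + (1 - a) * (1 - b) * x \<le> 0" using c by (simp add: algebra_simps)
    then have "0 \<le> (2 - c + (1 - a) * (1 - b) * x) * (w - - a * b / c * x / (1 + x))"
      using w by (intro mult_nonpos_nonpos) auto
    then have "0 \<le> boundary_profile a b c x w - boundary_profile a b c x (- a * b / c * x / (1 + x))"
      unfolding boundary_profile_diff[OF x(1) w1] using w1 x1 by (intro divide_nonneg_pos mult_pos_pos) auto
    then show ?thesis by simp
  qed
  show "boundary_profile a b c x (- a * b * x / (c + b * x)) \<le> boundary_profile a b c x w"
    if c: "c - 2 \<le> (1 - a) * (1 - b) * x"
  proof -
    have "0 \<le> (2 - c + (1 - a) * (1 - b) * x) * (w - - a * b * x / (c + b * x))"
      using w c by (intro mult_nonneg_nonneg) auto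
    then have "0 \<le> boundary_profile a b c x w - boundary_profile a b c x (- a * b * x / (c + b * x))"
      unfolding boundary_profile_diff[OF x(1) w1(1) lo] using w1 lo x1 by (intro divide_nonneg_pos mult_pos_pos) auto
    then show ?thesis by simp
  qed
qed

lemma eventually_at_left_one:
  assumes "d < (1 :: real)"
  shows "eventually (\<lambda>x. d < x \<and> x < 1) (at_left 1)"
  unfolding eventually_at_left[OF assms] by (intro exI[of _ d]) (auto simp: assms)

text \<open>
  The series need not converge at \<open>-1\<close>, so the comparison is made at \<open>- x\<close> and only the explicit lower
  bounds are carried to the limit \<open>x \<rightarrow> 1\<close>. In the second case the sign needed for monotonicity is
  available for \<open>x\<close> close to \<open>1\<close>.
\<close>
lemma hyp_shifted_lower_bound:
  assumes pos: "0 < a" "a < 1" "0 < b" "b \<le> 1" "a \<le> c" "b \<le> c" and z: "norm z < 1"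
    and R: "hausdorff R" "(1 - fps_X) * (fps_X * R) * (1 + \<omega>) =
      (fps_const (2 - c) + fps_const (a + b - 1) * fps_X) * \<omega> + fps_const (a * b) * fps_X"
    and \<omega>: "\<omega> = fps_const a * (hyp_ratio a b c - 1)"
  shows "3 - a - b + a * b \<le> c \<Longrightarrow>
      boundary_profile a b c 1 (- a * b / (2 * c)) \<le> Re (z * eval_fps (fps_complex R) z)"
    and "c < 3 - a - b + a * b \<Longrightarrow>
      boundary_profile a b c 1 (- a * b / (c + b)) \<le> Re (z * eval_fps (fps_complex R) z)"
proof -
  have c0: "c > 0" using pos by linarith
  have "a * b \<le> 1 * b" using pos by (intro mult_right_mono) auto
  then have ab: "a * b < 2 * c" "a * b < c + b" using pos c0 by linarith+
  have *: "\<exists>w. - a * b * x / (c + b * x) \<le> w \<and> w \<le> - a * b / c * x / (1 + x)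
      \<and> boundary_profile a b c x w \<le> Re (z * eval_fps (fps_complex R) z)"
    if "norm z < x" "x < 1" for x
  proof -
    have x: "0 \<le> x" "x < 1" using that norm_ge_zero[of z] by linarith+
    from boundary_profile_eq[OF pos x R \<omega>] hausdorff_Re_ge[OF R(1), of z x] that show ?thesis
      by (metis less_imp_le)
  qed
  show "boundary_profile a b c 1 (- a * b / (2 * c)) \<le> Re (z * eval_fps (fps_complex R) z)"
    if c: "3 - a - b + a * b \<le> c"
  proof (rule tendsto_upperbound)
    show "((\<lambda>x. boundary_profile a b c x (- a * b / c * x / (1 + x))) \<longlongrightarrow>
        boundary_profile a b c 1 (- a * b / (2 * c))) (at_left 1)"
    proof -
      have "((\<lambda>x. boundary_profile a b c x (- a * b / c * x / (1 + x))) \<longlongrightarrow>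
        boundary_profile a b c 1 (- a * b / c * 1 / (1 + 1))) (at_left 1)"
        unfolding boundary_profile_def using c0 ab
        by (intro tendsto_intros) (auto simp: field_simps)
      then show ?thesis by (simp add: mult.commute)
    qed
    show "\<forall>\<^sub>F x in at_left 1. boundary_profile a b c x (- a * b / c * x / (1 + x))
        \<le> Re (z * eval_fps (fps_complex R) z)"
      using eventually_at_left_one[OF z]
    proof eventually_elim
      case (elim x)
      then have x: "0 \<le> x" "x < 1" using norm_ge_zero[of z] by linarith+
      from *[of x] elim boundary_profile_lower(1)[OF pos x _ _ c] show ?case by force
    qed
  qed simp
  show "boundary_profile a b c 1 (- a * b / (c + b)) \<le> Re (z * eval_fps (fps_complex R) z)"
    if c: "c < 3 - a - b + a * b"
  proof (rule tendsto_upperbound)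
    show "((\<lambda>x. boundary_profile a b c x (- a * b * x / (c + b * x))) \<longlongrightarrow>
        boundary_profile a b c 1 (- a * b / (c + b))) (at_left 1)"
    proof -
      have "((\<lambda>x. boundary_profile a b c x (- a * b * x / (c + b * x))) \<longlongrightarrow>
        boundary_profile a b c 1 (- a * b * 1 / (c + b * 1))) (at_left 1)"
        unfolding boundary_profile_def using c0 ab pos
        by (intro tendsto_intros) (auto simp: field_simps)
      then show ?thesis by simp
    qed
    have "((\<lambda>x. (1 - a) * (1 - b) * x) \<longlongrightarrow> (1 - a) * (1 - b) * 1) (at_left 1)"
      by (intro tendsto_intros)
    then have "\<forall>\<^sub>F x in at_left 1. c - 2 < (1 - a) * (1 - b) * x"
      by (rule order_tendstoD(1)) (use c in \<open>simp add: algebra_simps\<close>)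
    then show "\<forall>\<^sub>F x in at_left 1. boundary_profile a b c x (- a * b * x / (c + b * x))
        \<le> Re (z * eval_fps (fps_complex R) z)"
      using eventually_at_left_one[OF z]
    proof eventually_elim
      case (elim x)
      then have x: "0 \<le> x" "x < 1" using norm_ge_zero[of z] by linarith+
      from *[of x] elim boundary_profile_lower(2)[OF pos x] show ?case by force
    qed
  qed simp
qed

text \<open>If \<open>P\<close> is a primitive of \<open>R\<close>, then \<open>h exp (- P)\<close> is constant.\<close>
lemma nonzero_of_log_derivative:
  fixes h R :: "complex \<Rightarrow> complex"
  assumes "convex S" "open S" "R holomorphic_on S"
    and h: "\<And>z. z \<in> S \<Longrightarrow> (h has_field_derivative R z * h z) (at z)"
    and z0: "z0 \<in> S" "h z0 \<noteq> 0" and z: "z \<in> S"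
  shows "h z \<noteq> 0"
proof -
  obtain P where P: "\<And>x. x \<in> S \<Longrightarrow> (P has_field_derivative R x) (at x within S)"
    using holomorphic_convex_primitive'[OF assms(1-3)] by blast
  have "((\<lambda>x. h x * exp (- P x)) has_field_derivative 0) (at x within S)" if "x \<in> S" for x
    by (rule derivative_eq_intros has_field_derivative_at_within[OF h] P that refl)+ (simp add: algebra_simps)
  then obtain C where C: "\<And>x. x \<in> S \<Longrightarrow> h x * exp (- P x) = C"
    using has_field_derivative_zero_constant[OF assms(1), of "\<lambda>x. h x * exp (- P x)"] by auto
  have "C \<noteq> 0" using C[OF z0(1)] z0(2) by auto
  then show ?thesis using C[OF z] by auto
qed

lemma shifted_hyp_order:
  assumes pos: "0 < a" "a < 1" "0 < b" "b \<le> 1" "a \<le> c"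
    and R: "hausdorff R" "fps_deriv (fps_deriv (fps_X * hyp_fps a b c)) = R * fps_deriv (fps_X * hyp_fps a b c)"
    and bound: "\<And>z. norm z < 1 \<Longrightarrow> k - 1 \<le> Re (z * eval_fps (fps_complex R) z)"
  shows "\<exists>\<kappa>. has_order_of_convexity (\<lambda>z. z * hyp2F1 a b c z) \<kappa> \<and> \<kappa> \<ge> ereal k"
proof -
  define f where "f = (\<lambda>z. z * hyp2F1 a b c z)"
  define G where "G = fps_complex (fps_X * hyp_fps a b c)"
  have convF: "disc_fps (fps_complex (hyp_fps a b c))"
    using pos by (intro disc_fps_hyp) auto
  have convG: "disc_fps G"
    unfolding G_def fps_complex_mult fps_complex_X using convF by (intro disc_fps_mult) auto
  then have convG': "disc_fps (fps_deriv G)"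
    using fps_conv_radius_deriv[of G] by (rule order_trans)
  have convR: "disc_fps (fps_complex R)" by (rule hausdorff_disc(2)[OF R(1)])
  have f_eq: "f z = eval_fps G z" if "z \<in> ball 0 1" for z
  proof -
    have "hyp2F1 a b c z = eval_fps (fps_complex (hyp_fps a b c)) z"
      by (simp add: hyp2F1_def eval_fps_def hyp_fps_nth)
    moreover have "eval_fps G z = z * eval_fps (fps_complex (hyp_fps a b c)) z"
      unfolding G_def fps_complex_mult fps_complex_X
      using that convF by (subst eval_fps_mult) (auto intro: disc_fps_normD)
    ultimately show ?thesis by (simp add: f_def)
  qed
  have dG: "(eval_fps G has_field_derivative eval_fps (fps_deriv G) z) (at z)"
    and dG': "(eval_fps (fps_deriv G) has_field_derivative
         eval_fps (fps_complex R) z * eval_fps (fps_deriv G) z) (at z)" if "z \<in> ball 0 1" for z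
  proof -
    show "(eval_fps G has_field_derivative eval_fps (fps_deriv G) z) (at z)"
      using that by (intro has_field_derivative_eval_fps disc_fps_normD convG) auto
    have "fps_deriv (fps_deriv G) = fps_complex R * fps_deriv G"
      using arg_cong[OF R(2), of fps_complex]
      by (simp only: G_def fps_complex_deriv fps_complex_mult)
    moreover have "(eval_fps (fps_deriv G) has_field_derivative eval_fps (fps_deriv (fps_deriv G)) z) (at z)"
      using that by (intro has_field_derivative_eval_fps disc_fps_normD convG') auto
    ultimately show "(eval_fps (fps_deriv G) has_field_derivative
         eval_fps (fps_complex R) z * eval_fps (fps_deriv G) z) (at z)"
      using that eval_fps_mult[OF disc_fps_normD[OF convR] disc_fps_normD[OF convG'], of z] by simp
  qed
  have df: "(f has_field_derivative eval_fps (fps_deriv G) z) (at z)" if "z \<in> ball 0 1" for z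
    by (rule has_field_derivative_transform_within_open[OF dG[OF that] open_ball that]) (simp add: f_eq)
  have deriv_f: "deriv f z = eval_fps (fps_deriv G) z" if "z \<in> ball 0 1" for z
    using df[OF that] by (rule DERIV_imp_deriv)
  have deriv2_f: "deriv (deriv f) z = eval_fps (fps_complex R) z * eval_fps (fps_deriv G) z"
    if "z \<in> ball 0 1" for z
    by (rule DERIV_imp_deriv, rule has_field_derivative_transform_within_open[OF dG'[OF that] open_ball that])
       (simp add: deriv_f)
  have G0: "eval_fps (fps_deriv G) 0 = 1"
    by (simp add: eval_fps_at_0 G_def)
  have nz: "eval_fps (fps_deriv G) z \<noteq> 0" if "z \<in> ball 0 1" for z
  proof -
    have "(ball 0 1 :: complex set) \<subseteq> eball 0 (fps_conv_radius (fps_complex R))"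
      using disc_fps_normD[OF convR] by (auto simp: dist_norm)
    then have "eval_fps (fps_complex R) holomorphic_on ball 0 1"
      by (rule holomorphic_on_eval_fps)
    from nonzero_of_log_derivative[OF convex_ball open_ball this, of "eval_fps (fps_deriv G)" 0 z]
    show ?thesis using dG' G0 that by simp
  qed
  define \<kappa> where "\<kappa> = 1 + (INF z\<in>ball 0 1. ereal (Re (z * deriv (deriv f) z / deriv f z)))"
  have "has_order_of_convexity f \<kappa>"
    unfolding has_order_of_convexity_def
  proof (intro conjI ballI)
    show "f holomorphic_on ball 0 1"
      unfolding holomorphic_on_open[OF open_ball] using df by blast
  qed (auto simp: f_def[THEN fun_cong] deriv_f G0 nz \<kappa>_def)
  moreover have "ereal k \<le> \<kappa>"
  proof -
    have "ereal (k - 1) \<le> (INF z\<in>ball 0 1. ereal (Re (z * deriv (deriv f) z / deriv f z)))"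
    proof (rule INF_greatest)
      fix z :: complex assume z: "z \<in> ball 0 1"
      have "z * deriv (deriv f) z / deriv f z = z * eval_fps (fps_complex R) z"
        using nz[OF z] by (simp add: deriv_f[OF z] deriv2_f[OF z])
      then show "ereal (k - 1) \<le> ereal (Re (z * deriv (deriv f) z / deriv f z))"
        using bound[of z] z by simp
    qed
    then have "1 + ereal (k - 1) \<le> \<kappa>" unfolding \<kappa>_def by (rule add_left_mono)
    then show ?thesis by (simp add: one_ereal_def)
  qed
  ultimately show ?thesis unfolding f_def by blast
qed

theorem corollary1p7:
  fixes a b c :: real
  assumes "0 < a" and "a < 1" and "a \<le> c"
    and "0 < b" and "b \<le> min 1 c"
  shows "(c \<ge> 3 - a - b + a * b \<longrightarrow>
           (\<exists>\<kappa>. has_order_of_convexity (\<lambda>z. z * hyp2F1 a b c z) \<kappa> \<and>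
             \<kappa> \<ge> ereal (((4 - a * b) * c - a * b * (5 - a - b)) / (2 * (2 * c - a * b)))))
       \<and> (1 + a + b - a * b \<le> c \<and> c < 3 - a - b + a * b \<longrightarrow>
           (\<exists>\<kappa>. has_order_of_convexity (\<lambda>z. z * hyp2F1 a b c z) \<kappa> \<and>
             \<kappa> \<ge> ereal ((2 * c + (a\<^sup>2 - 5 * a + 2) * b) / (2 * (b + c - a * b)))))"
proof (intro conjI impI)
  have pos: "0 < a" "a < 1" "0 < b" "b \<le> 1" "a \<le> c" "b \<le> c" using assms by auto
  have c0: "c > 0" using pos by linarith
  have "a * b \<le> 1 * b" using pos by (intro mult_right_mono) auto
  then have ab: "2 * c - a * b > 0" "b + c - a * b > 0" using pos c0 by linarith+
  show "\<exists>\<kappa>. has_order_of_convexity (\<lambda>z. z * hyp2F1 a b c z) \<kappa> \<and>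
             \<kappa> \<ge> ereal (((4 - a * b) * c - a * b * (5 - a - b)) / (2 * (2 * c - a * b)))"
    if c: "c \<ge> 3 - a - b + a * b"
  proof -
    have "0 \<le> (1 - a) * (1 - b)" using pos by simp
    then have "1 + a + b - a * b \<le> c" using c by (simp add: algebra_simps)
    then obtain R where R: "hausdorff R"
      "fps_deriv (fps_deriv (fps_X * hyp_fps a b c)) = R * fps_deriv (fps_X * hyp_fps a b c)"
      "(1 - fps_X) * (fps_X * R) * (1 + fps_const a * (hyp_ratio a b c - 1)) =
        (fps_const (2 - c) + fps_const (a + b - 1) * fps_X) * (fps_const a * (hyp_ratio a b c - 1))
        + fps_const (a * b) * fps_X"
      using hausdorff_log_derivative[OF pos] by blast
    have "((4 - a * b) * c - a * b * (5 - a - b)) / (2 * (2 * c - a * b)) - 1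
        = boundary_profile a b c 1 (- a * b / (2 * c))"
      using c0 ab unfolding boundary_profile_def by (simp add: divide_simps) (simp add: algebra_simps)
    then show ?thesis
      using hyp_shifted_lower_bound(1)[OF pos _ R(1,3) refl c]
      by (intro shifted_hyp_order[OF pos(1-5) R(1,2)]) simp
  qed
  show "\<exists>\<kappa>. has_order_of_convexity (\<lambda>z. z * hyp2F1 a b c z) \<kappa> \<and>
             \<kappa> \<ge> ereal ((2 * c + (a\<^sup>2 - 5 * a + 2) * b) / (2 * (b + c - a * b)))"
    if c: "1 + a + b - a * b \<le> c \<and> c < 3 - a - b + a * b"
  proof -
    obtain R where R: "hausdorff R"
      "fps_deriv (fps_deriv (fps_X * hyp_fps a b c)) = R * fps_deriv (fps_X * hyp_fps a b c)"
      "(1 - fps_X) * (fps_X * R) * (1 + fps_const a * (hyp_ratio a b c - 1)) =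
        (fps_const (2 - c) + fps_const (a + b - 1) * fps_X) * (fps_const a * (hyp_ratio a b c - 1))
        + fps_const (a * b) * fps_X"
      using hausdorff_log_derivative[OF pos] c by blast
    have "(2 * c + (a\<^sup>2 - 5 * a + 2) * b) / (2 * (b + c - a * b)) - 1
        = boundary_profile a b c 1 (- a * b / (c + b))"
      using c0 ab pos unfolding boundary_profile_def
      by (simp add: divide_simps power2_eq_square) (simp add: algebra_simps)
    then show ?thesis
      using hyp_shifted_lower_bound(2)[OF pos _ R(1,3) refl] c
      by (intro shifted_hyp_order[OF pos(1-5) R(1,2)]) simp
  qed
qed

end
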